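(* Let $u$ be a Leray–Hopf solution of the Navier–Stokes equations (unit viscosity, no force) on $\mathbb R^3$, on a time interval containing $(t_0-1,t_0)$; let $0<\rho\le\frac14$, $0<\sigma<1$, $r_k=2^{-k}$, $\ell_k=\sigma r_k$, and let $V_k^{+,\mathrm{far}}$ be the positive far-field stretching contribution at scale $k$ defined in the context. Then there is a constant $C_{\rho,\sigma,\chi,\varphi}$, depending only on the indicated data, such that $$V_k^{+,\mathrm{far}}\le C_{\rho,\sigma,\chi,\varphi}\,M_E^{3/2}\,2^{3k/2}\qquad\text{for all }k\ge0.$$ Consequently, for every nonnegative sequence $w=(w_k)_{k\ge0}$ with $\|w\|_{\mathcal W_{3/2}}:=\sum_{k\ge0}2^{3k/2}w_k<\infty$ and every $N$, $$\sum_{k=0}^{N}w_kV_k^{+,\mathrm{far}}\le C_{\rho,\sigma,\chi,\varphi}\,M_E^{3/2}\,\|w\|_{\mathcal W_{3/2}}.$$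
   Context: Fix $z_0=(x_0,t_0)$; $Q_k=B_{r_k}(x_0)\times(t_0-r_k^2,t_0)$. Filter: $\varphi\in C_c^\infty(B_1(0))$, $\varphi\ge0$, $\int\varphi=1$, $\varphi_\ell(x)=\ell^{-3}\varphi(x/\ell)$; $U_k=\varphi_{\ell_k}*u$ (in space), $\Omega_k=\operatorname{curl}U_k$, $\mathbb S_{\ell_k}=\frac12(\nabla U_k+\nabla U_k^T)$. Cutoffs $\chi_k(x,t)=\chi((x-x_0)/r_k,(t-t_0)/r_k^2)$ are parabolic rescalings of one fixed smooth profile $0\le\chi\le1$ compactly supported in $B_1(0)\times(-1,0)$. $M_E=\mathrm{ess\,sup}_t\|u(t)\|_{L^2(\mathbb R^3)}^2$. Splitting of the strain kernel at distance $\rho r_k$: $\vartheta\in C_c^\infty(B_1(0))$ is a fixed radial function with $0\le\vartheta\le1$, $\vartheta\equiv1$ on $B_{1/2}(0)$; $$\mathbb S_{\ell_k}^{\mathrm{near}}(x,t)=\frac{3}{8\pi}\,\mathrm{p.v.}\!\int_{\mathbb R^3}\vartheta\!\left(\frac z{\rho r_k}\right)\frac{(\widehat z\times\Omega_k(x-z,t))\otimes\widehat z+\widehat z\otimes(\widehat z\times\Omega_k(x-z,t))}{|z|^3}\,dz,\quad \widehat z=\frac z{|z|},$$ $\mathbb S_{\ell_k}^{\mathrm{far}}=\mathbb S_{\ell_k}-\mathbb S_{\ell_k}^{\mathrm{near}}$, and $$V_k^{+,\mathrm{far}}=r_k\iint_{Q_k}\chi_k\bigl(\mathbb S_{\ell_k}^{\mathrm{far}}\Omega_k\cdot\Omega_k\bigr)_+\,dx\,dt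 .$$ *)

theory Defs
  imports "HOL-Analysis.Analysis" "HOL-Probability.Essential_Supremum"
begin

primrec Ck :: "nat \<Rightarrow> ('a::euclidean_space \<Rightarrow> 'b::real_normed_vector) \<Rightarrow> bool" where
  "Ck 0 f \<longleftrightarrow> continuous_on UNIV f"
| "Ck (Suc n) f \<longleftrightarrow> (\<forall>x. f differentiable (at x)) \<and>
     (\<forall>v. Ck n (\<lambda>x. frechet_derivative f (at x) v))"

definition smooth :: "('a::euclidean_space \<Rightarrow> 'b::real_normed_vector) \<Rightarrow> bool" where
  "smooth f \<longleftrightarrow> (\<forall>n. Ck n f)"

definition supp :: "('a::euclidean_space \<Rightarrow> 'b::real_normed_vector) \<Rightarrow> 'a set" where
  "supp f = closure {x. f x \<noteq> 0}"

definition test_fun :: "'a set \<Rightarrow> ('a::euclidean_space \<Rightarrow> 'b::real_normed_vector) \<Rightarrow> bool" where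
  "test_fun A f \<longleftrightarrow> smooth f \<and> compact (supp f) \<and> supp f \<subseteq> A"

text \<open>The library's \<open>jacobian F (at x) $ i $ j\<close> is the partial derivative of the
  \<open>i\<close>-th component of \<open>F\<close> in direction \<open>j\<close>.\<close>

definition curl :: "(real^3 \<Rightarrow> real^3) \<Rightarrow> real^3 \<Rightarrow> real^3" where
  "curl F x = (let D = jacobian F (at x) in
     vector [D$3$2 - D$2$3, D$1$3 - D$3$1, D$2$1 - D$1$2])"

definition strain :: "(real^3 \<Rightarrow> real^3) \<Rightarrow> real^3 \<Rightarrow> real^3^3" where
  "strain F x = (1/2) *\<^sub>R (jacobian F (at x) + transpose (jacobian F (at x)))"

definition tensor :: "real^3 \<Rightarrow> real^3 \<Rightarrow> real^3^3" where
  "tensor a b = (\<chi> i j. a $ i * b $ j)"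


text \<open>Velocity fields are written \<open>u t x\<close>; points of
  space-time are pairs \<open>(x, t)\<close>.\<close>

definition L2sq :: "(real^3 \<Rightarrow> real^3) \<Rightarrow> ennreal" where
  "L2sq f = (\<integral>\<^sup>+ x. ennreal ((norm (f x))\<^sup>2) \<partial>lebesgue)"

definition in_L2 :: "(real^3 \<Rightarrow> real^3) \<Rightarrow> bool" where
  "in_L2 f \<longleftrightarrow> f \<in> borel_measurable lebesgue \<and> L2sq f < \<infinity>"

definition M_E :: "real set \<Rightarrow> (real \<Rightarrow> real^3 \<Rightarrow> real^3) \<Rightarrow> ennreal" where
  "M_E J u = esssup (lebesgue_on J) (\<lambda>t. L2sq (u t))"

definition weakly_div_free :: "(real^3 \<Rightarrow> real^3) \<Rightarrow> bool" where
  "weakly_div_free f \<longleftrightarrow>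
     (\<forall>\<psi>::real^3 \<Rightarrow> real. test_fun UNIV \<psi> \<longrightarrow>
        (LINT x|lebesgue. frechet_derivative \<psi> (at x) (f x)) = 0)"

definition weak_jacobian :: "(real^3 \<Rightarrow> real^3) \<Rightarrow> (real^3 \<Rightarrow> real^3^3) \<Rightarrow> bool" where
  "weak_jacobian f G \<longleftrightarrow>
     (\<forall>\<psi>::real^3 \<Rightarrow> real. test_fun UNIV \<psi> \<longrightarrow>
        (\<forall>i j. (LINT x|lebesgue. f x $ i * frechet_derivative \<psi> (at x) (axis j 1))
             = - (LINT x|lebesgue. G x $ i $ j * \<psi> x)))"

text \<open>Weak form of the momentum equation with unit viscosity and no force. Testing with
  divergence-free fields eliminates the pressure. The second term is
  \<open>(u \<otimes> u) : \<nabla>\<psi>\<close>; the inner product of matrices in the third is the Frobenius one.\<close>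

definition weak_momentum ::
    "real set \<Rightarrow> (real \<Rightarrow> real^3 \<Rightarrow> real^3) \<Rightarrow> (real \<Rightarrow> real^3 \<Rightarrow> real^3^3) \<Rightarrow> bool" where
  "weak_momentum J u G \<longleftrightarrow>
     (\<forall>\<psi>::(real^3) \<times> real \<Rightarrow> real^3.
        test_fun (UNIV \<times> interior J) \<psi> \<and>
        (\<forall>x t. trace (jacobian (\<lambda>y. \<psi> (y, t)) (at x)) = 0) \<longrightarrow>
        (LINT (x, t):UNIV \<times> J|lebesgue.
             u t x \<bullet> vector_derivative (\<lambda>s. \<psi> (x, s)) (at t)
           + u t x \<bullet> frechet_derivative (\<lambda>y. \<psi> (y, t)) (at x) (u t x)
           - G t x \<bullet> jacobian (\<lambda>y. \<psi> (y, t)) (at x)) = 0)"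

definition energy_ineq_from ::
    "real set \<Rightarrow> (real \<Rightarrow> real^3 \<Rightarrow> real^3) \<Rightarrow> (real \<Rightarrow> real^3 \<Rightarrow> real^3^3) \<Rightarrow> real \<Rightarrow> bool" where
  "energy_ineq_from J u G s \<longleftrightarrow>
     (\<forall>t\<in>J. s \<le> t \<longrightarrow>
        L2sq (u t)
          + 2 * (\<integral>\<^sup>+ (x, \<tau>)\<in>UNIV \<times> {s..t}. ennreal ((norm (G \<tau> x))\<^sup>2) \<partial>lebesgue)
        \<le> L2sq (u s))"

text \<open>A Leray--Hopf solution is identified with its weakly continuous representative, so
  that every time slice is meaningful and \<open>u a\<close> is the initial datum if \<open>J\<close> has a first
  time \<open>a\<close>. The energy inequality is then required from that first time; if there is none,
  it is required from almost every starting time. The weak gradient \<open>G\<close> is determined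
  by \<open>u\<close> up to null sets.\<close>

definition leray_hopf :: "real set \<Rightarrow> (real \<Rightarrow> real^3 \<Rightarrow> real^3) \<Rightarrow> bool" where
  "leray_hopf J u \<longleftrightarrow>
     is_interval J \<and>
     (\<lambda>(x, t). u t x) \<in> borel_measurable (lebesgue_on (UNIV \<times> J)) \<and>
     (\<forall>t\<in>J. in_L2 (u t) \<and> weakly_div_free (u t)) \<and>
     M_E J u < \<infinity> \<and>
     (\<forall>v. in_L2 v \<longrightarrow> continuous_on J (\<lambda>t. LINT x|lebesgue. u t x \<bullet> v x)) \<and>
     (\<exists>G. (\<lambda>(x, t). G t x) \<in> borel_measurable (lebesgue_on (UNIV \<times> J)) \<and>
          (\<integral>\<^sup>+ (x, t)\<in>UNIV \<times> J. ennreal ((norm (G t x))\<^sup>2) \<partial>lebesgue) < \<infinity> \<and>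
          (AE t in lebesgue_on J. weak_jacobian (u t) (G t)) \<and>
          weak_momentum J u G \<and>
          (\<forall>a\<in>J. (\<forall>t\<in>J. a \<le> t) \<longrightarrow> energy_ineq_from J u G a) \<and>
          ((\<forall>a\<in>J. \<exists>t\<in>J. t < a) \<longrightarrow> (AE s in lebesgue_on J. energy_ineq_from J u G s)))"


text \<open>The space-time cutoff profile is called \<open>\<eta>\<close>, since the symbol usually used for
  it is the binder for vectors.\<close>

definition filter_profile :: "(real^3 \<Rightarrow> real) \<Rightarrow> bool" where
  "filter_profile \<phi> \<longleftrightarrow> test_fun (ball 0 1) \<phi> \<and> (\<forall>x. 0 \<le> \<phi> x) \<and> (LINT x|lebesgue. \<phi> x) = 1"

definition cutoff_profile :: "((real^3) \<times> real \<Rightarrow> real) \<Rightarrow> bool" where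
  "cutoff_profile \<eta> \<longleftrightarrow>
     test_fun (ball 0 1 \<times> {-1<..<0}) \<eta> \<and> (\<forall>p. 0 \<le> \<eta> p \<and> \<eta> p \<le> 1)"

definition splitting_profile :: "(real^3 \<Rightarrow> real) \<Rightarrow> bool" where
  "splitting_profile \<theta> \<longleftrightarrow>
     test_fun (ball 0 1) \<theta> \<and> (\<forall>x y. norm x = norm y \<longrightarrow> \<theta> x = \<theta> y) \<and>
     (\<forall>x. 0 \<le> \<theta> x \<and> \<theta> x \<le> 1) \<and> (\<forall>x\<in>ball 0 (1/2). \<theta> x = 1)"

definition mollify :: "(real^3 \<Rightarrow> real) \<Rightarrow> real \<Rightarrow> (real^3 \<Rightarrow> real^3) \<Rightarrow> real^3 \<Rightarrow> real^3" where
  "mollify \<phi> l f x = (LINT y|lebesgue. (\<phi> ((x - y) /\<^sub>R l) / l ^ 3) *\<^sub>R f y)"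

definition pv_integral :: "(real^3 \<Rightarrow> 'a::euclidean_space) \<Rightarrow> 'a" where
  "pv_integral f = Lim (at_right 0) (\<lambda>\<epsilon>. LINT z:{z. \<epsilon> < norm z}|lebesgue. f z)"

text \<open>Here \<open>sgn z\<close> is the unit vector \<open>z / |z|\<close>, and \<open>d\<close> is the splitting distance.\<close>

definition strain_near ::
    "(real^3 \<Rightarrow> real) \<Rightarrow> real \<Rightarrow> (real^3 \<Rightarrow> real^3) \<Rightarrow> real^3 \<Rightarrow> real^3^3" where
  "strain_near \<theta> d \<Omega> x =
     (3 / (8 * pi)) *\<^sub>R pv_integral (\<lambda>z.
        (\<theta> (z /\<^sub>R d) / norm z ^ 3) *\<^sub>R
          (tensor (cross3 (sgn z) (\<Omega> (x - z))) (sgn z)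
           + tensor (sgn z) (cross3 (sgn z) (\<Omega> (x - z)))))"

definition strain_far ::
    "(real^3 \<Rightarrow> real) \<Rightarrow> real \<Rightarrow> (real^3 \<Rightarrow> real^3) \<Rightarrow> real^3 \<Rightarrow> real^3^3" where
  "strain_far \<theta> d U x = strain U x - strain_near \<theta> d (curl U) x"

definition rad :: "nat \<Rightarrow> real" where
  "rad k = 1 / 2 ^ k"

definition Q :: "real^3 \<Rightarrow> real \<Rightarrow> nat \<Rightarrow> ((real^3) \<times> real) set" where
  "Q x0 t0 k = ball x0 (rad k) \<times> {t0 - (rad k)\<^sup>2<..<t0}"

text \<open>The integrand is nonnegative, so the integral is taken in \<open>[0, \<infinity>]\<close>.\<close>

definition V_far ::
    "(real^3 \<Rightarrow> real) \<Rightarrow> ((real^3) \<times> real \<Rightarrow> real) \<Rightarrow> (real^3 \<Rightarrow> real) \<Rightarrow> real \<Rightarrow> real \<Rightarrow>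
     real^3 \<Rightarrow> real \<Rightarrow> (real \<Rightarrow> real^3 \<Rightarrow> real^3) \<Rightarrow> nat \<Rightarrow> ennreal" where
  "V_far \<phi> \<eta> \<theta> \<rho> \<sigma> x0 t0 u k =
     ennreal (rad k) *
     (\<integral>\<^sup>+ (x, t)\<in>Q x0 t0 k.
        (let U = mollify \<phi> (\<sigma> * rad k) (u t); \<Omega> = curl U x in
         ennreal (\<eta> ((x - x0) /\<^sub>R rad k, (t - t0) / (rad k)\<^sup>2) *
                  max 0 ((strain_far \<theta> (\<rho> * rad k) U x *v \<Omega>) \<bullet> \<Omega>))) \<partial>lebesgue)"

end

theory Submission
  imports Defs
begin

text \<open>
  No Biot--Savart representation of the strain is needed: the far strain is the full strain
  minus the near strain, and for a fixed time both are bounded pointwise by a multiple of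
  \<open>r powr (-5/2) * sqrt M\<close>, with \<open>r = rad k\<close> and \<open>M = M_E J u\<close>, as is the vorticity \<open>\<Omega>\<close>. For the
  full strain and \<open>\<Omega>\<close> this is Cauchy--Schwarz applied to the mollified velocity, whose
  derivatives fall on the filter. The strain kernel has mean zero over spheres, so in the
  principal value \<open>\<Omega> (x - z)\<close> may be replaced by \<open>\<Omega> (x - z) - \<Omega> x\<close>. This improves the
  singularity to \<open>1 / |z|\<^sup>2\<close> and bounds the near strain by the splitting distance times the
  Lipschitz constant of \<open>\<Omega>\<close>. The product of the three bounds, the volume \<open>r ^ 5\<close> of the cylinder
  and the prefactor \<open>r\<close> is \<open>r powr (-3/2) * M powr (3/2)\<close>. Of \<open>\<theta>\<close> only the bound by one, the
  radial symmetry and the support enter, so the constant does not depend on it.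
\<close>

section \<open>Gradients of test functions\<close>

lemma eq_0_outside_supp: "x \<notin> supp f \<Longrightarrow> f x = 0"
  using closure_subset[of "{x. f x \<noteq> 0}"] by (auto simp: supp_def)

text \<open>The derivative is continuous and vanishes off the compact set \<open>K\<close>, so each
  derivative along a basis vector is bounded. The sum of these bounds controls the operator norm,
  and the mean value inequality applies on the whole space.\<close>

lemma Ck1_compact_support_lipschitz:
  fixes f :: "'a::euclidean_space \<Rightarrow> 'b::real_normed_vector"
  assumes f: "Ck (Suc 0) f" and K: "compact K" and zero: "\<And>x. x \<notin> K \<Longrightarrow> f x = 0"
  obtains L where "0 \<le> L" "\<And>x y. norm (f x - f y) \<le> L * norm (x - y)"
proof -
  let ?D = "\<lambda>x. frechet_derivative f (at x)"
  have deriv: "(f has_derivative ?D x) (at x)" for x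
    using f by (simp add: frechet_derivative_works)
  have cont: "continuous_on UNIV (\<lambda>x. ?D x v)" for v
    using f by simp
  have outside: "?D x = (\<lambda>_. 0)" if "x \<notin> K" for x
  proof -
    have "((\<lambda>_. 0) has_derivative ?D x) (at x)"
      using that K zero by (intro has_derivative_transform_within_open[OF deriv, of "- K"])
        (auto simp: compact_imp_closed open_Compl)
    then show ?thesis
      using has_derivative_unique has_derivative_const by blast
  qed
  have "\<exists>B. \<forall>x. norm (?D x b) \<le> B" for b
  proof -
    have "bounded ((\<lambda>x. ?D x b) ` K)"
      by (intro compact_imp_bounded compact_continuous_image K continuous_on_subset[OF cont]) simp
    then obtain B where "0 < B" "\<And>x. x \<in> K \<Longrightarrow> norm (?D x b) \<le> B"
      unfolding bounded_pos by blast
    then have "norm (?D x b) \<le> B" for x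
      by (cases "x \<in> K") (auto simp: outside)
    then show ?thesis by blast
  qed
  then obtain B where B: "\<And>b x. norm (?D x b) \<le> B b"
    by metis
  show ?thesis
  proof
    have "0 \<le> B b" for b
      using order_trans[OF norm_ge_zero B] .
    then show "0 \<le> (\<Sum>b\<in>Basis. B b)"
      by (intro sum_nonneg)
    have "onorm (?D x) \<le> (\<Sum>b\<in>Basis. B b)" for x
      using onorm_componentwise[OF has_derivative_bounded_linear[OF deriv]]
      by (rule order_trans) (intro sum_mono B)
    then show "norm (f x - f y) \<le> (\<Sum>b\<in>Basis. B b) * norm (x - y)" for x y
      using deriv by (intro differentiable_bound[of UNIV f ?D]) auto
  qed
qed

text \<open>The later constants see the filter only through \<open>A\<close> and \<open>L\<close>.
  The Lipschitz bound comes from applying the previous lemma to each partial derivative, which is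
  again continuously differentiable with compact support.\<close>

lemma test_fun_gradient:
  fixes \<phi> :: "'a::euclidean_space \<Rightarrow> real"
  assumes "test_fun (ball 0 1) \<phi>"
  obtains g A L where "0 \<le> A" "0 \<le> L"
    "\<And>z. (\<phi> has_derivative (\<lambda>h. g z \<bullet> h)) (at z)"
    "\<And>z. norm (g z) \<le> A"
    "\<And>z z'. norm (g z - g z') \<le> L * norm (z - z')"
    "\<And>z. 1 \<le> norm z \<Longrightarrow> \<phi> z = 0"
    "\<And>z. 1 \<le> norm z \<Longrightarrow> g z = 0"
proof -
  have Ck: "Ck n \<phi>" for n
    using assms by (simp add: test_fun_def smooth_def)
  have K: "compact (supp \<phi>)" "supp \<phi> \<subseteq> ball 0 1"
    using assms by (auto simp: test_fun_def smooth_def)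
  define D where "D = (\<lambda>x. frechet_derivative \<phi> (at x))"
  \<comment> \<open>The vector representing the linear map \<open>D z\<close> through the inner
    product.\<close>
  define g where "g z = (\<Sum>b\<in>Basis. D z b *\<^sub>R b)" for z
  have deriv: "(\<phi> has_derivative D z) (at z)" for z
    using Ck[of 1] by (simp add: D_def frechet_derivative_works)
  have D_g: "D z h = g z \<bullet> h" for z h
  proof -
    interpret bounded_linear "D z"
      using deriv by (rule has_derivative_bounded_linear)
    have "D z h = D z (\<Sum>b\<in>Basis. (h \<bullet> b) *\<^sub>R b)"
      by (simp add: euclidean_representation)
    also have "\<dots> = g z \<bullet> h"
      by (simp add: sum scaleR g_def inner_sum_left) (simp add: inner_commute mult.commute)
    finally show ?thesis .
  qed
  have D_outside: "D z b = 0" if "z \<notin> supp \<phi>" for z b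
  proof -
    have "((\<lambda>_. 0) has_derivative D z) (at z)"
      using that eq_0_outside_supp[of _ \<phi>] K by (intro has_derivative_transform_within_open[OF deriv, of "- supp \<phi>"])
        (auto simp: compact_imp_closed open_Compl)
    then have "D z = (\<lambda>_. 0)"
      using has_derivative_unique has_derivative_const by blast
    then show ?thesis by simp
  qed
  then have g_outside: "g z = 0" if "z \<notin> supp \<phi>" for z
    using that by (simp add: g_def)
  have "\<exists>L. \<forall>x y. norm (D x b - D y b) \<le> L * norm (x - y)" for b
  proof -
    have "Ck (Suc 0) (\<lambda>x. D x b)"
      using Ck[of "Suc (Suc 0)", unfolded Ck.simps(2)[of "Suc 0"]] unfolding D_def by blast
    then obtain L where "\<And>x y. norm (D x b - D y b) \<le> L * norm (x - y)"
      using Ck1_compact_support_lipschitz[of "\<lambda>x. D x b", OF _ K(1) D_outside] by metis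
    then show ?thesis by blast
  qed
  then obtain L where L: "\<And>b x y. norm (D x b - D y b) \<le> L b * norm (x - y)"
    by metis
  define M where "M = (\<Sum>b\<in>Basis. L b)"
  have g_lip: "norm (g x - g y) \<le> M * norm (x - y)" for x y
  proof -
    have "g x - g y = (\<Sum>b\<in>Basis. (D x b - D y b) *\<^sub>R b)"
      by (simp add: g_def scaleR_diff_left sum_subtractf)
    also have "norm \<dots> \<le> (\<Sum>b\<in>Basis. L b * norm (x - y))"
      using L by (intro sum_norm_le) simp
    finally show ?thesis
      by (simp add: M_def sum_distrib_right)
  qed
  \<comment> \<open>The constants \<open>L b\<close> were obtained without a sign, hence the
    absolute value.\<close>
  have lip: "norm (g x - g y) \<le> \<bar>M\<bar> * norm (x - y)" for x y
    using g_lip[of x y] mult_right_mono[OF abs_ge_self[of M] norm_ge_zero[of "x - y"]] by linarith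
  have "continuous_on UNIV g"
    by (rule lipschitz_on_continuous_on[OF lipschitz_onI[of _ g "\<bar>M\<bar>"]]) (auto simp: dist_norm lip)
  then have "bounded (g ` supp \<phi>)"
    by (intro compact_imp_bounded compact_continuous_image K(1)) (rule continuous_on_subset, auto)
  then obtain A where "0 < A" "\<And>z. z \<in> supp \<phi> \<Longrightarrow> norm (g z) \<le> A"
    unfolding bounded_pos by blast
  then have A: "norm (g z) \<le> A" for z
    by (cases "z \<in> supp \<phi>") (auto simp: g_outside)
  show ?thesis
  proof
    show "0 \<le> A" using \<open>0 < A\<close> by simp
    show "0 \<le> \<bar>M\<bar>" by simp
    show "(\<phi> has_derivative (\<lambda>h. g z \<bullet> h)) (at z)" for z
      using deriv[of z] D_g by (simp add: D_g[abs_def])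
    show "norm (g z - g z') \<le> \<bar>M\<bar> * norm (z - z')" for z z' by (rule lip)
    show "\<phi> z = 0" if "1 \<le> norm z" for z
      using that K by (intro eq_0_outside_supp) auto
    show "g z = 0" if "1 \<le> norm z" for z
      using that K by (intro g_outside) auto
  qed (rule A)
qed

text \<open>Mean value inequality for \<open>\<phi> (a + s) - g a \<bullet> s\<close> on the ball of
  radius \<open>norm k\<close>, where its gradient \<open>g (a + s) - g a\<close> is at most
  \<open>L * norm k\<close>. The sharp constant would be \<open>L / 2\<close>.\<close>

lemma gradient_lipschitz_taylor:
  fixes \<phi> :: "'a::euclidean_space \<Rightarrow> real"
  assumes deriv: "\<And>z. (\<phi> has_derivative (\<lambda>h. g z \<bullet> h)) (at z)"
    and lip: "\<And>z z'. norm (g z - g z') \<le> L * norm (z - z')" and "0 \<le> L"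
  shows "\<bar>\<phi> (a + k) - \<phi> a - g a \<bullet> k\<bar> \<le> L * (norm k)\<^sup>2"
proof -
  let ?p = "\<lambda>s. \<phi> (a + s) - g a \<bullet> s"
  have "norm (?p k - ?p 0) \<le> (L * norm k) * norm (k - 0)"
  proof (rule differentiable_bound[of "cball 0 (norm k)"])
    fix s :: 'a assume s: "s \<in> cball 0 (norm k)"
    have "((\<lambda>s. \<phi> (a + s)) has_derivative (\<lambda>h. g (a + s) \<bullet> h)) (at s within cball 0 (norm k))"
      by (rule has_derivative_compose[of "\<lambda>s. a + s" "\<lambda>h. h" s "cball 0 (norm k)" \<phi>, OF _ deriv])
        (auto intro!: derivative_eq_intros)
    then show "(?p has_derivative (\<lambda>h. (g (a + s) - g a) \<bullet> h)) (at s within cball 0 (norm k))"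
      by (auto intro!: derivative_eq_intros simp: inner_diff_left)
    have "norm (g (a + s) - g a) \<le> L * norm s"
      using lip[of "a + s" a] by simp
    also have "\<dots> \<le> L * norm k"
      using s \<open>0 \<le> L\<close> by (intro mult_left_mono) auto
    finally show "onorm (\<lambda>h. (g (a + s) - g a) \<bullet> h) \<le> L * norm k"
      using Cauchy_Schwarz_ineq2[of "g (a + s) - g a"]
      by (intro onorm_le) (fastforce intro: order_trans[OF _ mult_right_mono])
  qed auto
  then show ?thesis
    by (simp add: power2_eq_square algebra_simps)
qed

section \<open>The principal value of the strain kernel\<close>

lemma emeasure_ball3:
  "0 \<le> r \<Longrightarrow> emeasure lborel (ball (x::real^3) r) = ennreal (unit_ball_vol 3 * r ^ 3)"
  using emeasure_ball[of r x] by simp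

section \<open>Reflections and odd integrands\<close>

lemma distr_orthogonal_transformation:
  fixes R :: "real^'n::{finite,wellorder} \<Rightarrow> real^'n::_"
  assumes R: "orthogonal_transformation R"
  shows "distr lborel borel R = lborel"
proof (rule lborel_eqI[symmetric])
  have "linear R" using R by (rule orthogonal_transformation_linear)
  then have [measurable]: "R \<in> borel_measurable borel"
    by (intro borel_measurable_continuous_onI linear_continuous_on) (simp add: linear_linear)
  fix a b :: "real^'n::{finite,wellorder}"
  assume ab: "\<And>i. i \<in> Basis \<Longrightarrow> a \<bullet> i \<le> b \<bullet> i"
  have bij: "bij R" using R by (rule orthogonal_transformation_bij)
  \<comment> \<open>The preimage becomes an image under \<open>inv R\<close>, which is again
    orthogonal, so the invariance of measure for orthogonal images applies.\<close>
  have vimage: "R -` box a b = inv R ` box a b"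
    using bij by (simp add: bij_vimage_eq_inv_image)
  have "inv R ` box a b \<in> lmeasurable" "measure lebesgue (inv R ` box a b) = measure lebesgue (box a b)"
    by (intro measurable_orthogonal_image measure_orthogonal_image orthogonal_transformation_inv R; simp)+
  then have "emeasure lebesgue (R -` box a b) = emeasure lebesgue (box a b)"
    unfolding vimage by (metis emeasure_eq_measure2 lmeasurable_box)
  moreover have "R -` box a b \<in> sets borel"
    using measurable_sets[of R borel borel "box a b"] by simp
  ultimately show "emeasure (distr lborel borel R) (box a b) = (\<Prod>i\<in>Basis. (b - a) \<bullet> i)"
    using ab by (simp add: emeasure_distr emeasure_lborel_box_eq)
qed simp

text \<open>Substituting \<open>R z\<close> for \<open>z\<close> preserves the integral, because
  Lebesgue measure is invariant, and also flips its sign.\<close>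

lemma integral_reflection_odd:
  fixes F :: "real^3 \<Rightarrow> real"
  assumes [measurable]: "F \<in> borel_measurable borel"
    and R: "orthogonal_transformation R" and odd: "\<And>z. F (R z) = - F z"
  shows "(LINT z|lborel. F z) = 0"
proof -
  have "linear R" using R by (rule orthogonal_transformation_linear)
  then have R_meas: "R \<in> borel_measurable borel"
    by (intro borel_measurable_continuous_onI linear_continuous_on) (simp add: linear_linear)
  have "(LINT z|lborel. F z) = (LINT z|distr lborel borel R. F z)"
    by (simp add: distr_orthogonal_transformation[OF R])
  also have "\<dots> = (LINT z|lborel. F (R z))"
    by (rule integral_distr) (simp_all add: R_meas)
  also have "\<dots> = - (LINT z|lborel. F z)"
    by (simp add: odd)
  finally show ?thesis by simp
qed

lemma reflection_orthogonal:
  fixes n :: "'a::real_inner"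
  assumes "n \<noteq> 0"
  shows "orthogonal_transformation (\<lambda>z. z - (2 * (z \<bullet> n) / (n \<bullet> n)) *\<^sub>R n)"
  unfolding orthogonal_transformation_def
proof (intro conjI allI linearI)
  fix v w
  show "(v - (2 * (v \<bullet> n) / (n \<bullet> n)) *\<^sub>R n) \<bullet> (w - (2 * (w \<bullet> n) / (n \<bullet> n)) *\<^sub>R n) = v \<bullet> w"
    using assms by (simp add: inner_diff_left inner_diff_right inner_commute field_simps)
qed (simp_all add: inner_add_left algebra_simps add_divide_distrib)

text \<open>Angular part of the strain kernel; the cutoff and the factor
  \<open>1 / norm z ^ 3\<close> stay outside. The vorticity value \<open>w\<close> is a separate
  argument, so that values at \<open>x - z\<close> and at \<open>x\<close> can be compared in the
  same direction. At \<open>z = 0\<close> the kernel is 0, because \<open>sgn 0 = 0\<close>.\<close>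

definition strain_kernel :: "real^3 \<Rightarrow> real^3 \<Rightarrow> real^3^3" where
  "strain_kernel w z = tensor (cross3 (sgn z) w) (sgn z) + tensor (sgn z) (cross3 (sgn z) w)"

lemma norm_tensor: "norm (tensor a b) = norm a * norm b"
proof -
  have "(norm (tensor a b))\<^sup>2 = (norm a * norm b)\<^sup>2"
    by (simp add: power_mult_distrib power2_norm_eq_inner tensor_def inner_vec_def sum_3)
      (simp add: algebra_simps)
  then show ?thesis
    by (simp add: power2_eq_iff_nonneg)
qed

lemma norm_strain_kernel: "norm (strain_kernel w z) \<le> 2 * norm w"
proof -
  \<comment> \<open>Lagrange's identity: the squares of the cross product and of the inner product
    add up to the product of the squared norms.\<close>
  have "(norm (cross3 (sgn z) w))\<^sup>2 \<le> (norm (sgn z) * norm w)\<^sup>2"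
    using norm_cross_dot[of "sgn z" w] by (metis le_add_same_cancel1 zero_le_power2)
  then have "norm (cross3 (sgn z) w) \<le> norm (sgn z) * norm w"
    by (rule power2_le_imp_le) simp
  also have "\<dots> \<le> 1 * norm w"
    by (intro mult_right_mono) (simp_all add: norm_sgn)
  finally have c: "norm (cross3 (sgn z) w) \<le> norm w" by simp
  have "norm (strain_kernel w z) \<le> 2 * (norm (sgn z) * norm (cross3 (sgn z) w))"
    unfolding strain_kernel_def by (rule order_trans[OF norm_triangle_ineq]) (simp add: norm_tensor)
  also have "norm (sgn z) * norm (cross3 (sgn z) w) \<le> 1 * norm w"
    by (intro mult_mono c) (simp_all add: norm_sgn)
  finally show ?thesis by simp
qed

lemma strain_kernel_symmetric: "strain_kernel w z $ i $ j = strain_kernel w z $ j $ i"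
  by (simp add: strain_kernel_def tensor_def)

lemma strain_kernel_diff: "strain_kernel (w - w') z = strain_kernel w z - strain_kernel w' z"
  by (simp add: strain_kernel_def tensor_def vec_eq_iff Cross3.right_diff_distrib algebra_simps)

text \<open>Since \<open>cross3 w \<xi>\<close> is orthogonal to \<open>\<xi>\<close>, the form is a
  product of two linear forms in \<open>sgn z\<close> with orthogonal coefficient vectors. Such a
  product averages to zero over spheres.\<close>

lemma strain_kernel_quadratic:
  "(strain_kernel w z *v \<xi>) \<bullet> \<xi> = 2 * (sgn z \<bullet> cross3 w \<xi>) * (sgn z \<bullet> \<xi>)"
  by (simp add: strain_kernel_def tensor_def matrix_vector_mult_def cross3_simps)

lemma strain_kernel_measurable[measurable]:
  assumes [measurable]: "W \<in> borel_measurable borel"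
  shows "(\<lambda>z. strain_kernel (W z) z) \<in> borel_measurable borel"
proof -
  \<comment> \<open>\<open>sgn\<close> is discontinuous at 0. Continuity is therefore used for the
    map on pairs (direction, vector) and only measurability for \<open>sgn\<close>.\<close>
  have "continuous_on UNIV (\<lambda>p. tensor (cross3 (fst p) (snd p)) (fst p) + tensor (fst p) (cross3 (fst p) (snd p)))"
    unfolding tensor_def by (intro continuous_intros continuous_on_cross)
  then have "(\<lambda>p. tensor (cross3 (fst p) (snd p)) (fst p) + tensor (fst p) (cross3 (fst p) (snd p)))
      \<in> borel_measurable borel"
    by (rule borel_measurable_continuous_onI)
  then have "(\<lambda>z. (\<lambda>p. tensor (cross3 (fst p) (snd p)) (fst p) + tensor (fst p) (cross3 (fst p) (snd p))) (sgn z, W z)) \<in> borel_measurable borel"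
    by (rule measurable_compose[rotated]) (simp add: sgn_div_norm)
  then show ?thesis by (simp add: strain_kernel_def)
qed

text \<open>Dyadic shells take the place of polar coordinates. The exact value is
  \<open>3 * unit_ball_vol 3 * d\<close>, so the comparison costs only a constant factor.\<close>

lemma nn_integral_inverse_square_ball:
  fixes d :: real
  assumes d: "0 < d"
  shows "(\<integral>\<^sup>+ z. ennreal (indicator (ball (0 :: real^3) d) z * (1 / (norm z)\<^sup>2)) \<partial>lborel)
    \<le> ennreal (8 * unit_ball_vol 3 * d)" (is "?I \<le> _")
proof -
  \<comment> \<open>Each \<open>z\<close> is compared with the term of its own dyadic shell \<open>d / 2\<^sup>n\<^sup>+\<^sup>1 \<le> |z| < d / 2\<^sup>n\<close>.\<close>
  let ?t = "\<lambda>n z. ennreal (4 ^ Suc n / d\<^sup>2) * indicator (ball 0 (d / 2 ^ n)) (z :: real^3)"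
  have "ennreal (indicator (ball 0 d) z * (1 / (norm z)\<^sup>2)) \<le> (\<Sum>n. ?t n z)" for z :: "real^3"
  proof (cases "z \<noteq> 0 \<and> norm z < d")
    case True
    let ?P = "\<lambda>n. d / 2 ^ Suc n \<le> norm z"
    obtain m where "(1/2) ^ m < norm z / d"
      using real_arch_pow_inv[of "norm z / d" "1/2"] True d by auto
    then have "?P m"
      using d by (simp add: power_divide divide_simps mult.commute)
    \<comment> \<open>Minimality of \<open>n\<close> gives \<open>norm z < d / 2 ^ n\<close>; for
      \<open>n = 0\<close> this is the case assumption \<open>norm z < d\<close>.\<close>
    define n where "n = (LEAST n. ?P n)"
    have P: "?P n"
      unfolding n_def by (rule LeastI[of ?P, OF \<open>?P m\<close>])
    have less: "norm z < d / 2 ^ n"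
    proof (cases n)
      case (Suc k)
      then have "\<not> ?P k"
        unfolding n_def by (intro not_less_Least) simp
      with Suc show ?thesis by simp
    qed (use True in simp)
    have "d\<^sup>2 \<le> (norm z * 2 ^ Suc n)\<^sup>2"
      using P d by (intro power_mono) (simp_all add: divide_simps)
    also have "\<dots> = (norm z)\<^sup>2 * 4 ^ Suc n"
      by (simp only: power_mult_distrib power_mult[symmetric] mult.commute[of _ 2]) (simp add: power_mult)
    finally have "ennreal (indicator (ball 0 d) z * (1 / (norm z)\<^sup>2)) \<le> ?t n z"
      using True less d by (simp add: divide_simps mult.commute ennreal_leI)
    also have "\<dots> \<le> (\<Sum>n. ?t n z)"
      using sum_le_suminf[of "\<lambda>n. ?t n z" "{n}", OF summableI]
      by (simp only: sum.insert sum.empty finite.intros empty_iff not_False_eq_True add_0_right zero_le simp_thms)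
    finally show ?thesis .
  \<comment> \<open>At the origin the left side is 0 because division by zero yields 0; for
    \<open>norm z \<ge> d\<close> the indicator vanishes.\<close>
  qed (auto simp: indicator_def)
  then have "?I \<le> (\<integral>\<^sup>+ z. (\<Sum>n. ?t n z) \<partial>lborel)"
    by (intro nn_integral_mono)
  also have "\<dots> = (\<Sum>n. \<integral>\<^sup>+ z. ?t n z \<partial>lborel)"
    by (intro nn_integral_suminf borel_measurable_times_ennreal borel_measurable_indicator) simp_all
  \<comment> \<open>The bound grows like \<open>4 ^ n\<close> and the volume decays like
    \<open>1 / 8 ^ n\<close>, which leaves a geometric series of ratio 1/2.\<close>
  also have "\<dots> = (\<Sum>n. ennreal (4 * unit_ball_vol 3 * d * (1/2) ^ n))"
  proof (rule suminf_cong)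
    fix n
    have "(\<integral>\<^sup>+ z. ?t n z \<partial>lborel) = ennreal (4 ^ Suc n / d\<^sup>2) * ennreal (unit_ball_vol 3 * (d / 2 ^ n) ^ 3)"
      using d by (simp add: nn_integral_cmult_indicator emeasure_ball3)
    also have "\<dots> = ennreal (4 ^ Suc n / d\<^sup>2 * (unit_ball_vol 3 * (d / 2 ^ n) ^ 3))"
      using d by (intro ennreal_mult[symmetric]) auto
    also have "4 ^ Suc n / d\<^sup>2 * (unit_ball_vol 3 * (d / 2 ^ n) ^ 3) = 4 * unit_ball_vol 3 * d * (1/2) ^ n"
    proof -
      have "(4::real) ^ n = 2 ^ n * 2 ^ n" by (simp add: power_mult_distrib[symmetric])
      then show ?thesis
        using d by (simp add: divide_simps power2_eq_square power3_eq_cube)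
    qed
    finally show "(\<integral>\<^sup>+ z. ?t n z \<partial>lborel) = ennreal (4 * unit_ball_vol 3 * d * (1/2) ^ n)" .
  qed
  also have "\<dots> = ennreal (8 * unit_ball_vol 3 * d)"
  proof (rule suminf_ennreal_eq)
    show "(\<lambda>n. 4 * unit_ball_vol 3 * d * (1/2) ^ n) sums (8 * unit_ball_vol 3 * d)"
      using sums_mult[OF geometric_sums[of "1/2 :: real"], of "4 * unit_ball_vol 3 * d"]
      by (simp add: mult.assoc)
  qed (use d in simp)
  finally show ?thesis .
qed

section \<open>Cancellation of the kernel over spheres\<close>

lemma symmetric_quadratic_form_eq_0:
  fixes S :: "real^'n^'n"
  assumes sym: "\<And>i j. S $ i $ j = S $ j $ i" and zero: "\<And>\<xi>. (S *v \<xi>) \<bullet> \<xi> = 0"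
  shows "S = 0"
proof -
  have entry: "(S *v axis i 1) \<bullet> axis j 1 = S $ j $ i" for i j
    by (simp add: matrix_vector_mult_basis column_def inner_axis)
  \<comment> \<open>Polarisation: by symmetry the two mixed terms at
    \<open>axis i 1 + axis j 1\<close> coincide.\<close>
  have "S $ i $ j = 0" for i j
    using zero[of "axis i 1 + axis j 1"] zero[of "axis i 1"] zero[of "axis j 1"] sym[of i j]
    by (simp add: matrix_vector_right_distrib inner_add_left inner_add_right entry)
  then show ?thesis by (simp add: vec_eq_iff)
qed

text \<open>The integral is a symmetric matrix, so it suffices that its quadratic form vanishes.
  Linear functionals pass through the integral, which leaves a scalar integrand that is odd under a
  reflection. A general radial weight \<open>k\<close> covers the truncated kernels of the principal
  value.\<close>

lemma strain_kernel_mean_zero: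
  fixes k :: "real^3 \<Rightarrow> real"
  assumes [measurable]: "k \<in> borel_measurable borel"
    and radial: "\<And>z z'. norm z = norm z' \<Longrightarrow> k z = k z'"
    and int: "integrable lborel (\<lambda>z. k z *\<^sub>R strain_kernel w z)"
  shows "(LINT z|lborel. k z *\<^sub>R strain_kernel w z) = 0" (is "?Z = 0")
proof (rule symmetric_quadratic_form_eq_0)
  have T: "T ?Z = (LINT z|lborel. T (k z *\<^sub>R strain_kernel w z))" if "linear T" for T :: "real^3^3 \<Rightarrow> real"
    using that int by (intro integral_bounded_linear[symmetric]) (simp_all add: linear_linear)
  have "linear (\<lambda>A::real^3^3. A $ i $ j)" for i j
    by (rule linearI) simp_all
  from T[OF this] show "?Z $ i $ j = ?Z $ j $ i" for i j
    using strain_kernel_symmetric[of w _ i j] by simp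
  fix \<xi>
  define n where "n = cross3 w \<xi>"
  let ?F = "\<lambda>z. k z * (2 * (sgn z \<bullet> n) * (sgn z \<bullet> \<xi>))"
  have "linear (\<lambda>A::real^3^3. (A *v \<xi>) \<bullet> \<xi>)"
    by (rule linearI) (simp_all add: matrix_vector_mult_add_rdistrib inner_add_left scaleR_matrix_vector_assoc[symmetric])
  from T[OF this] have "(?Z *v \<xi>) \<bullet> \<xi> = (LINT z|lborel. ?F z)"
    by (simp add: scaleR_matrix_vector_assoc[symmetric] strain_kernel_quadratic n_def)
  also have "\<dots> = 0"
  proof (cases "n = 0")
    case False
    \<comment> \<open>As \<open>n\<close> is orthogonal to \<open>\<xi>\<close>, the reflection with normal \<open>n\<close> flips \<open>z \<bullet> n\<close> and fixes \<open>z \<bullet> \<xi>\<close>.\<close>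
    let ?R = "\<lambda>z. z - (2 * (z \<bullet> n) / (n \<bullet> n)) *\<^sub>R n"
    note R = reflection_orthogonal[OF False]
    have norm: "norm (?R z) = norm z" for z
      by (rule orthogonal_transformation_norm[OF R])
    have "n \<bullet> \<xi> = 0"
      by (simp add: n_def dot_cross_self)
    then have "sgn (?R z) \<bullet> \<xi> = sgn z \<bullet> \<xi>" for z
      by (simp only: sgn_div_norm norm) (simp add: inner_diff_left)
    moreover have "sgn (?R z) \<bullet> n = - (sgn z \<bullet> n)" for z
      using False by (simp only: sgn_div_norm norm) (simp add: inner_diff_left)
    moreover have "k (?R z) = k z" for z
      by (rule radial[OF norm])
    ultimately have odd: "?F (?R z) = - ?F z" for z
      by simp
    show ?thesis
      by (rule integral_reflection_odd[where F = ?F and R = ?R, OF _ R odd]) (simp add: sgn_div_norm)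
  qed simp
  finally show "(?Z *v \<xi>) \<bullet> \<xi> = 0" .
qed

text \<open>\<open>pv_integral\<close> is a \<open>Lim\<close>, so convergence has to be shown
  before the value can be estimated. Subtracting \<open>\<Omega> x\<close> changes no truncated
  integral and leaves the integrand \<open>H\<close>, of size at most
  \<open>2 * b / (norm z)\<^sup>2\<close> on the ball of radius \<open>d\<close>. With the factor 8
  of the inverse-square bound this gives 16.\<close>

lemma pv_strain_kernel:
  fixes \<Omega> :: "real^3 \<Rightarrow> real^3"
  assumes \<theta>_cont: "continuous_on UNIV \<theta>" and \<theta>_bound: "\<And>z. \<bar>\<theta> z\<bar> \<le> 1"
    and \<theta>_zero: "\<And>z. 1 \<le> norm z \<Longrightarrow> \<theta> z = 0"
    and radial: "\<And>z z'. norm z = norm z' \<Longrightarrow> \<theta> z = \<theta> z'"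
    and lip: "\<And>x y. norm (\<Omega> x - \<Omega> y) \<le> b * norm (x - y)" and "0 \<le> b" and d: "0 < d"
  shows "norm (pv_integral (\<lambda>z. (\<theta> (z /\<^sub>R d) / norm z ^ 3) *\<^sub>R strain_kernel (\<Omega> (x - z)) z))
    \<le> 16 * b * unit_ball_vol 3 * d"
proof -
  define c where "c z = \<theta> (z /\<^sub>R d) / norm z ^ 3" for z :: "real^3"
  define H where "H z = c z *\<^sub>R strain_kernel (\<Omega> (x - z) - \<Omega> x) z" for z
  let ?far = "\<lambda>\<epsilon>. indicat_real {z :: real^3. \<epsilon> < norm z}"
  have \<Omega>_cont: "continuous_on UNIV \<Omega>"
    by (rule lipschitz_on_continuous_on[OF lipschitz_onI[of _ \<Omega> b]]) (auto simp: dist_norm lip \<open>0 \<le> b\<close>)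
  have "continuous_on UNIV (\<lambda>z :: real^3. \<theta> (z /\<^sub>R d))" "continuous_on UNIV (\<lambda>z. \<Omega> (x - z))"
    by (intro continuous_intros continuous_on_compose2[OF \<theta>_cont] continuous_on_compose2[OF \<Omega>_cont]; simp)+
  from this[THEN borel_measurable_continuous_onI]
  have [measurable]: "c \<in> borel_measurable borel" "(\<lambda>z. \<Omega> (x - z)) \<in> borel_measurable borel"
    unfolding c_def by (simp_all add: borel_measurable_divide)
  have H_meas[measurable]: "H \<in> borel_measurable borel"
    unfolding H_def by measurable
  have c_bound: "\<bar>c z\<bar> \<le> indicator (ball 0 d) z / norm z ^ 3" for z
  proof (cases "norm z < d")
    case True
    then show ?thesis using \<theta>_bound by (simp add: c_def divide_right_mono)
  next
    case False
    then have "\<theta> (z /\<^sub>R d) = 0"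
      using d by (intro \<theta>_zero) (simp add: divide_simps)
    then show ?thesis by (simp add: c_def)
  qed
  have H_bound: "norm (H z) \<le> 2 * b * (indicator (ball 0 d) z * (1 / (norm z)\<^sup>2))" for z
  proof -
    have "norm (strain_kernel (\<Omega> (x - z) - \<Omega> x) z) \<le> 2 * (b * norm z)"
      using lip[of "x - z" x] by (intro order_trans[OF norm_strain_kernel]) simp
    then have "norm (H z) \<le> (indicator (ball 0 d) z / norm z ^ 3) * (2 * (b * norm z))"
      unfolding H_def norm_scaleR using c_bound by (intro mult_mono) auto
    also have "\<dots> = 2 * b * (indicator (ball 0 d) z * (1 / (norm z)\<^sup>2))"
      by (simp add: power2_eq_square power3_eq_cube)
    finally show ?thesis .
  qed
  \<comment> \<open>The radius is kept free: \<open>r = d\<close> yields integrability and the final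
    bound, \<open>r = 2 * \<epsilon>\<close> the truncation error.\<close>
  have near: "(\<integral>\<^sup>+ z. ennreal (indicator (ball 0 r) z * norm (H z)) \<partial>lborel) \<le> ennreal (16 * b * unit_ball_vol 3 * r)"
    if "0 < r" for r
  proof -
    \<comment> \<open>By \<open>H_bound\<close>, \<open>H\<close> vanishes outside the ball of
      radius \<open>d\<close>, so the estimate also holds there when \<open>r\<close> exceeds
      \<open>d\<close>.\<close>
    have "indicator (ball 0 r) z * norm (H z) \<le> 2 * b * (indicator (ball 0 r) z * (1 / (norm z)\<^sup>2))" for z
      using H_bound[of z] \<open>0 \<le> b\<close> by (cases "norm z < d") (auto simp: indicator_def)
    then have "ennreal (indicator (ball 0 r) z * norm (H z))
        \<le> ennreal (2 * b) * ennreal (indicator (ball 0 r) z * (1 / (norm z)\<^sup>2))" for z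
      using \<open>0 \<le> b\<close> by (subst ennreal_mult'[symmetric]) (simp, intro ennreal_leI)
    then have "(\<integral>\<^sup>+ z. ennreal (indicator (ball 0 r) z * norm (H z)) \<partial>lborel)
        \<le> (\<integral>\<^sup>+ (z :: real^3). ennreal (2 * b) * ennreal (indicator (ball 0 r) z * (1 / (norm z)\<^sup>2)) \<partial>lborel)"
      by (intro nn_integral_mono)
    also have "\<dots> \<le> ennreal (2 * b) * ennreal (8 * unit_ball_vol 3 * r)"
    proof (subst nn_integral_cmult)
      show "(\<lambda>z :: real^3. ennreal (indicator (ball 0 r) z * (1 / (norm z)\<^sup>2))) \<in> borel_measurable lborel"
        by (intro measurable_compose[OF _ measurable_ennreal] borel_measurable_times
            borel_measurable_indicator borel_measurable_divide) simp_all
    qed (intro mult_left_mono nn_integral_inverse_square_ball that, simp)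
    also have "\<dots> = ennreal (16 * b * unit_ball_vol 3 * r)"
      using that \<open>0 \<le> b\<close> by (simp add: ennreal_mult'[symmetric])
    finally show ?thesis .
  qed
  have H_ball: "indicator (ball 0 d) z * norm (H z) = norm (H z)" for z
    using H_bound[of z] by (auto simp: indicator_def split: if_splits)
  have H_int: "integrable lborel H"
    using near[OF d] by (intro integrableI_bounded) (auto simp: H_ball top_unique less_top[symmetric])
  have H_near_int: "integrable lborel (\<lambda>z. indicator (ball 0 r) z * norm (H z))" for r :: real
    by (rule Bochner_Integration.integrable_bound[OF H_int]) (auto simp: indicator_def)
  have near': "(LINT z|lborel. indicator (ball 0 r) z * norm (H z)) \<le> 16 * b * unit_ball_vol 3 * r" if "0 < r" for r
    using near[OF that] that \<open>0 \<le> b\<close> by (simp add: nn_integral_eq_integral[OF H_near_int])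
  have punctured: "(LINT z:{z. \<epsilon> < norm z}|lebesgue. c z *\<^sub>R strain_kernel (\<Omega> (x - z)) z)
      = (LINT z|lborel. ?far \<epsilon> z *\<^sub>R H z)" if "0 < \<epsilon>" for \<epsilon>
  proof -
    \<comment> \<open>The contribution of the constant vector \<open>\<Omega> x\<close>. Beyond
      distance \<open>\<epsilon>\<close> it is bounded by
      \<open>2 * norm (\<Omega> x) / \<epsilon> ^ 3\<close>, hence integrable on its own, and it
      cancels by radial symmetry.\<close>
    let ?K = "\<lambda>z. (?far \<epsilon> z * c z) *\<^sub>R strain_kernel (\<Omega> x) z"
    have dom: "integrable lborel (\<lambda>z :: real^3. indicator (ball 0 d) z * (2 * norm (\<Omega> x) / \<epsilon> ^ 3))"
      using emeasure_ball3[of d 0] d by (intro integrable_mult_left integrable_real_indicator) auto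
    have K_le: "norm (?K z) \<le> indicator (ball 0 d) z * (2 * norm (\<Omega> x) / \<epsilon> ^ 3)" for z
    proof (cases "\<epsilon> < norm z")
      case True
      have "\<bar>c z\<bar> \<le> indicator (ball 0 d) z / \<epsilon> ^ 3"
        using True \<open>0 < \<epsilon>\<close>
        by (intro order_trans[OF c_bound] divide_left_mono power_mono mult_pos_pos zero_less_power) auto
      then have "\<bar>c z\<bar> * norm (strain_kernel (\<Omega> x) z)
          \<le> (indicator (ball 0 d) z / \<epsilon> ^ 3) * (2 * norm (\<Omega> x))"
        using norm_strain_kernel \<open>0 < \<epsilon>\<close> by (intro mult_mono) simp_all
      then have "norm (?K z) \<le> (indicator (ball 0 d) z / \<epsilon> ^ 3) * (2 * norm (\<Omega> x))"
        using True by simp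
      then show ?thesis by simp
    qed (use \<open>0 < \<epsilon>\<close> in simp)
    have K_int: "integrable lborel ?K"
    proof (rule Bochner_Integration.integrable_bound[OF dom])
      show "AE z in lborel. norm (?K z) \<le> norm (indicator (ball 0 d) z * (2 * norm (\<Omega> x) / \<epsilon> ^ 3))"
        using \<open>0 < \<epsilon>\<close> by (intro AE_I2 order_trans[OF K_le]) simp
    qed measurable
    have "(LINT z|lborel. ?K z) = 0"
    proof (rule strain_kernel_mean_zero[OF _ _ K_int])
      show "?far \<epsilon> z * c z = ?far \<epsilon> z' * c z'" if "norm z = norm z'" for z z'
        using that radial[of "z /\<^sub>R d" "z' /\<^sub>R d"] by (simp add: c_def indicator_def)
    qed measurable
    moreover have "integrable lborel (\<lambda>z. ?far \<epsilon> z *\<^sub>R H z)"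
      by (rule Bochner_Integration.integrable_bound[OF H_int]) (auto simp: indicator_def)
    ultimately have "(LINT z|lborel. ?far \<epsilon> z *\<^sub>R H z) = (LINT z|lborel. ?far \<epsilon> z *\<^sub>R H z + ?K z)"
      using K_int by simp
    also have "\<dots> = (LINT z|lborel. ?far \<epsilon> z *\<^sub>R (c z *\<^sub>R strain_kernel (\<Omega> (x - z)) z))"
      by (intro Bochner_Integration.integral_cong) (simp_all add: H_def strain_kernel_diff algebra_simps)
    also have "\<dots> = (LINT z:{z. \<epsilon> < norm z}|lebesgue. c z *\<^sub>R strain_kernel (\<Omega> (x - z)) z)"
      unfolding set_lebesgue_integral_def by (rule integral_completion[symmetric]) measurable
    finally show ?thesis ..
  qed
  have error: "norm ((LINT z|lborel. ?far \<epsilon> z *\<^sub>R H z) - (LINT z|lborel. H z)) \<le> 32 * b * unit_ball_vol 3 * \<epsilon>"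
    if "0 < \<epsilon>" for \<epsilon>
  proof -
    have far_int: "integrable lborel (\<lambda>z. ?far \<epsilon> z *\<^sub>R H z)"
      by (rule Bochner_Integration.integrable_bound[OF H_int]) (auto simp: indicator_def)
    then have "(LINT z|lborel. ?far \<epsilon> z *\<^sub>R H z) - (LINT z|lborel. H z) = (LINT z|lborel. ?far \<epsilon> z *\<^sub>R H z - H z)"
      using H_int by simp
    \<comment> \<open>The truncation removes a closed ball of radius \<open>\<epsilon>\<close>; the
      open ball of twice that radius contains it.\<close>
    also have "norm \<dots> \<le> (LINT z|lborel. indicator (ball 0 (2 * \<epsilon>)) z * norm (H z))"
      using that by (intro Bochner_Integration.integral_norm_bound_integral H_near_int Bochner_Integration.integrable_diff far_int H_int)
        (auto simp: indicator_def)
    also have "\<dots> \<le> 16 * b * unit_ball_vol 3 * (2 * \<epsilon>)"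
      using that by (intro near') simp
    finally show ?thesis by simp
  qed
  have "((\<lambda>\<epsilon>. LINT z:{z. \<epsilon> < norm z}|lebesgue. c z *\<^sub>R strain_kernel (\<Omega> (x - z)) z) \<longlongrightarrow> (LINT z|lborel. H z)) (at_right 0)"
  proof (rule Lim_transform_eventually)
    show "\<forall>\<^sub>F \<epsilon> in at_right 0. (LINT z|lborel. ?far \<epsilon> z *\<^sub>R H z)
        = (LINT z:{z. \<epsilon> < norm z}|lebesgue. c z *\<^sub>R strain_kernel (\<Omega> (x - z)) z)"
      using punctured by (auto simp: eventually_at_filter)
    show "((\<lambda>\<epsilon>. LINT z|lborel. ?far \<epsilon> z *\<^sub>R H z) \<longlongrightarrow> (LINT z|lborel. H z)) (at_right 0)"
    proof (rule LIM_zero_cancel, rule Lim_null_comparison)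
      show "\<forall>\<^sub>F \<epsilon> in at_right 0. norm ((LINT z|lborel. ?far \<epsilon> z *\<^sub>R H z) - (LINT z|lborel. H z)) \<le> 32 * b * unit_ball_vol 3 * \<epsilon>"
        using error by (auto simp: eventually_at_filter)
      show "((\<lambda>\<epsilon>. 32 * b * unit_ball_vol 3 * \<epsilon>) \<longlongrightarrow> 0) (at_right 0)"
        by (auto intro!: tendsto_eq_intros)
    qed
  qed
  then have "pv_integral (\<lambda>z. c z *\<^sub>R strain_kernel (\<Omega> (x - z)) z) = (LINT z|lborel. H z)"
    unfolding pv_integral_def by (intro tendsto_Lim) simp_all
  also have "norm \<dots> \<le> (LINT z|lborel. norm (H z))"
    by (rule integral_norm_bound)
  also have "\<dots> \<le> 16 * b * unit_ball_vol 3 * d"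
    using near'[OF d] by (simp add: H_ball)
  finally show ?thesis by (simp add: c_def)
qed

section \<open>Mollification of square-integrable fields\<close>

text \<open>Cauchy-Schwarz between \<open>f\<close> and the indicator of the ball. It is carried out
  in \<open>ennreal\<close>, and the finiteness of the result then gives integrability.\<close>

lemma L2_ball:
  fixes f :: "real^3 \<Rightarrow> real^3"
  assumes f[measurable]: "f \<in> borel_measurable lebesgue"
    and M: "L2sq f \<le> ennreal M" "0 \<le> M" and "0 \<le> l"
  shows "integrable lebesgue (\<lambda>y. indicator (ball x l) y * norm (f y))"
    and "(LINT y|lebesgue. indicator (ball x l) y * norm (f y)) \<le> sqrt (unit_ball_vol 3 * l ^ 3 * M)"
proof -
  let ?I = "\<integral>\<^sup>+ y. ennreal (indicator (ball x l) y * norm (f y)) \<partial>lebesgue"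
  let ?c = "unit_ball_vol 3 * l ^ 3 * M"
  have c: "0 \<le> ?c" using assms by simp
  have "?I\<^sup>2 = (\<integral>\<^sup>+ y. indicator (ball x l) y * ennreal (norm (f y)) \<partial>lebesgue)\<^sup>2"
    by (simp add: ennreal_mult' ennreal_indicator)
  also have "\<dots> \<le> (\<integral>\<^sup>+ y. (indicator (ball x l) y)\<^sup>2 \<partial>lebesgue) * (\<integral>\<^sup>+ y. (ennreal (norm (f y)))\<^sup>2 \<partial>lebesgue)"
    by (rule Cauchy_Schwarz_nn_integral) (auto intro!: borel_measurable_indicator f)
  also have "(\<integral>\<^sup>+ y. (indicator (ball x l) y)\<^sup>2 \<partial>lebesgue) = (\<integral>\<^sup>+ y. indicator (ball x l) y \<partial>lebesgue)"
    by (intro nn_integral_cong) (simp add: indicator_def)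
  also have "\<dots> = ennreal (unit_ball_vol 3 * l ^ 3)"
    using \<open>0 \<le> l\<close> by (simp add: emeasure_ball3)
  also have "(\<integral>\<^sup>+ y. (ennreal (norm (f y)))\<^sup>2 \<partial>lebesgue) = L2sq f"
    by (simp add: L2sq_def ennreal_power)
  also have "ennreal (unit_ball_vol 3 * l ^ 3) * L2sq f \<le> ennreal (unit_ball_vol 3 * l ^ 3) * ennreal M"
    by (intro mult_left_mono M) simp
  also have "\<dots> = ennreal ?c"
    using \<open>0 \<le> l\<close> M by (simp add: ennreal_mult)
  finally have I2: "?I\<^sup>2 \<le> ennreal ?c" .
  have I: "?I \<le> ennreal (sqrt ?c)"
  proof (cases ?I)
    case (real r)
    with I2 c have "r\<^sup>2 \<le> ?c"
      by (simp add: ennreal_power del: mult_le_cancel_left)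
    with real show ?thesis
      using real_le_rsqrt by (simp add: ennreal_leI)
  next
    case top
    with I2 show ?thesis
      by (simp add: power2_eq_square ennreal_top_mult top_unique)
  qed
  show int: "integrable lebesgue (\<lambda>y. indicator (ball x l) y * norm (f y))"
    using I by (intro integrableI_bounded borel_measurable_times borel_measurable_indicator)
      (auto simp: top_unique less_top[symmetric])
  have "ennreal (LINT y|lebesgue. indicator (ball x l) y * norm (f y)) = ?I"
    by (rule nn_integral_eq_integral[symmetric, OF int]) auto
  with I show "(LINT y|lebesgue. indicator (ball x l) y * norm (f y)) \<le> sqrt ?c"
    using ennreal_le_iff real_sqrt_ge_zero[OF c] by metis
qed

text \<open>Two centres are allowed because a difference of kernels centred at \<open>x\<close> and
  \<open>x'\<close> lives on the union of two balls. A single kernel is the case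
  \<open>x' = x\<close>; the factor 2 counts the balls.\<close>

lemma L2_pairing_two_balls:
  fixes f :: "real^3 \<Rightarrow> real^3"
  assumes f[measurable]: "f \<in> borel_measurable lebesgue"
    and M: "L2sq f \<le> ennreal M" "0 \<le> M" and "0 \<le> l"
    and w[measurable]: "w \<in> borel_measurable lebesgue"
    and bound: "\<And>y. norm (w y) \<le> a" and "0 \<le> a"
    and zero: "\<And>y. l \<le> norm (x - y) \<Longrightarrow> l \<le> norm (x' - y) \<Longrightarrow> w y = 0"
  shows "integrable lebesgue (\<lambda>y. w y *\<^sub>R f y)"
    and "norm (LINT y|lebesgue. w y *\<^sub>R f y) \<le> 2 * a * sqrt (unit_ball_vol 3 * l ^ 3 * M)"
proof -
  let ?b = "\<lambda>x y. indicator (ball x l) y * norm (f y)"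
  note ball = L2_ball[OF f M \<open>0 \<le> l\<close>]
  have int: "integrable lebesgue (\<lambda>y. a * (?b x y + ?b x' y))"
    by (intro integrable_mult_right Bochner_Integration.integrable_add ball)
  have le: "norm (w y *\<^sub>R f y) \<le> a * (?b x y + ?b x' y)" for y
  proof (cases "y \<in> ball x l \<or> y \<in> ball x' l")
    case True
    then have "norm (f y) \<le> ?b x y + ?b x' y"
      by (auto simp: indicator_def)
    then show ?thesis
      using bound[of y] \<open>0 \<le> a\<close> by (auto intro!: mult_mono)
  next
    case False
    then have "w y = 0"
      by (intro zero) (auto simp: dist_norm)
    then show ?thesis
      using \<open>0 \<le> a\<close> by simp
  qed
  show int': "integrable lebesgue (\<lambda>y. w y *\<^sub>R f y)"
    by (rule Bochner_Integration.integrable_bound[OF int])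
      (measurable, use le in \<open>auto simp del: norm_scaleR intro: order_trans[OF _ abs_ge_self]\<close>)
  have "norm (LINT y|lebesgue. w y *\<^sub>R f y) \<le> (LINT y|lebesgue. a * (?b x y + ?b x' y))"
    by (rule Bochner_Integration.integral_norm_bound_integral[OF int' int le])
  also have "\<dots> = a * ((LINT y|lebesgue. ?b x y) + (LINT y|lebesgue. ?b x' y))"
    using ball by simp
  also have "\<dots> \<le> a * (sqrt (unit_ball_vol 3 * l ^ 3 * M) + sqrt (unit_ball_vol 3 * l ^ 3 * M))"
    using ball \<open>0 \<le> a\<close> by (intro mult_left_mono add_mono)
  finally show "norm (LINT y|lebesgue. w y *\<^sub>R f y) \<le> 2 * a * sqrt (unit_ball_vol 3 * l ^ 3 * M)"
    by simp
qed

text \<open>The derivative falls on the filter: \<open>D x h\<close> integrates \<open>f\<close>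
  against the derivative of the rescaled profile. Differentiability follows from the quadratic
  Taylor remainder of the profile, paired with \<open>f\<close> by Cauchy-Schwarz. The normalisation
  contributes \<open>l ^ 3\<close> and each derivative one further \<open>l\<close>, hence the
  powers 4 and 5.\<close>

lemma mollify_derivative:
  fixes f :: "real^3 \<Rightarrow> real^3"
  assumes deriv: "\<And>z. (\<phi> has_derivative (\<lambda>h. g z \<bullet> h)) (at z)"
    and A: "\<And>z. norm (g z) \<le> A" "0 \<le> A"
    and lip: "\<And>z z'. norm (g z - g z') \<le> L * norm (z - z')" and "0 \<le> L"
    and \<phi>_zero: "\<And>z. 1 \<le> norm z \<Longrightarrow> \<phi> z = 0" and g_zero: "\<And>z. 1 \<le> norm z \<Longrightarrow> g z = 0"
    and f[measurable]: "f \<in> borel_measurable lebesgue"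
    and M: "L2sq f \<le> ennreal M" "0 \<le> M" and l: "0 < l"
  defines "I \<equiv> sqrt (unit_ball_vol 3 * l ^ 3 * M)"
  obtains D where "\<And>x. (mollify \<phi> l f has_derivative D x) (at x)"
    "\<And>x h. norm (D x h) \<le> 2 * (A / l ^ 4) * I * norm h"
    "\<And>x x' h. norm (D x h - D x' h) \<le> 2 * (L / l ^ 5) * I * norm (x - x') * norm h"
proof -
  define p where "p x y = \<phi> ((x - y) /\<^sub>R l) / l ^ 3" for x y
  define q where "q x h y = (g ((x - y) /\<^sub>R l) \<bullet> h) / l ^ 4" for x h y
  define D where "D x h = (LINT y|lebesgue. q x h y *\<^sub>R f y)" for x h
  have U: "mollify \<phi> l f x = (LINT y|lebesgue. p x y *\<^sub>R f y)" for x
    by (simp add: mollify_def p_def)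
  have far: "1 \<le> norm ((x - y) /\<^sub>R l) \<longleftrightarrow> l \<le> norm (x - y)" for x y :: "real^3"
    using l by (simp add: divide_simps divide_inverse_commute[symmetric])
  have cont_\<phi>: "continuous_on UNIV \<phi>"
    using has_derivative_continuous[OF deriv] by (simp add: continuous_on_eq_continuous_at)
  have cont_g: "continuous_on UNIV g"
    by (rule lipschitz_on_continuous_on[OF lipschitz_onI[of _ g L]]) (auto simp: dist_norm lip \<open>0 \<le> L\<close>)
  have p_cont: "continuous_on UNIV (p x)" for x
    unfolding p_def using l by (intro continuous_intros continuous_on_compose2[OF cont_\<phi>]) auto
  have p_meas[measurable]: "p x \<in> borel_measurable lebesgue" for x
    by (simp add: measurable_completion borel_measurable_continuous_onI p_cont)
  have q_cont: "continuous_on UNIV (q x h)" for x h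
    unfolding q_def using l by (intro continuous_intros continuous_on_compose2[OF cont_g]) auto
  have q_meas[measurable]: "q x h \<in> borel_measurable lebesgue" for x h
    by (simp add: measurable_completion borel_measurable_continuous_onI q_cont)
  note pairing = L2_pairing_two_balls[OF f M less_imp_le[OF l], folded I_def]

  \<comment> \<open>The bound \<open>B\<close> serves the integrability of
    \<open>p x y *\<^sub>R f y\<close> and does not enter the final estimates.\<close>
  have "bounded (\<phi> ` cball 0 1)"
    by (intro compact_imp_bounded compact_continuous_image continuous_on_subset[OF cont_\<phi>]) auto
  then obtain B where B: "0 < B" "\<And>z. z \<in> cball 0 1 \<Longrightarrow> norm (\<phi> z) \<le> B"
    unfolding bounded_pos by blast
  have \<phi>_bound: "norm (\<phi> z) \<le> B" for z
    using B(1) B(2)[of z] \<phi>_zero[of z] by (cases "norm z \<le> 1") auto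
  have p_int: "integrable lebesgue (\<lambda>y. p x y *\<^sub>R f y)" for x
  proof (rule pairing(1)[where x = x and x' = x and a = "B / l ^ 3"])
    show "norm (p x y) \<le> B / l ^ 3" for y
      using \<phi>_bound l by (auto simp: p_def intro!: divide_right_mono)
    show "p x y = 0" if "l \<le> norm (x - y)" for y
      using that far by (simp add: p_def \<phi>_zero)
  qed (use B l in auto)
  have q_bound: "norm (q x h y) \<le> A / l ^ 4 * norm h" for x h y
  proof -
    have "\<bar>g ((x - y) /\<^sub>R l) \<bullet> h\<bar> \<le> A * norm h"
      using Cauchy_Schwarz_ineq2 mult_right_mono[OF A(1) norm_ge_zero] by (rule order_trans)
    then show ?thesis
      using l by (simp add: q_def divide_right_mono)
  qed
  have q_zero: "q x h y = 0" if "l \<le> norm (x - y)" for x h y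
    using that far by (simp add: q_def g_zero)
  have q_int: "integrable lebesgue (\<lambda>y. q x h y *\<^sub>R f y)" for x h
    by (rule pairing(1)[where x = x and x' = x, OF q_meas q_bound]) (use A l q_zero in auto)
  have D_bound: "norm (D x h) \<le> 2 * (A / l ^ 4) * I * norm h" for x h
  proof -
    have "norm (D x h) \<le> 2 * (A / l ^ 4 * norm h) * I"
      unfolding D_def
      by (rule pairing(2)[where x = x and x' = x, OF q_meas q_bound]) (use A l q_zero in auto)
    then show ?thesis by (simp add: mult_ac)
  qed
  have D_lip: "norm (D x h - D x' h) \<le> 2 * (L / l ^ 5) * I * norm (x - x') * norm h" for x x' h
  proof -
    have "norm (q x h y - q x' h y) \<le> L / l ^ 5 * norm (x - x') * norm h" for y
    proof -
      have "\<bar>(g ((x - y) /\<^sub>R l) - g ((x' - y) /\<^sub>R l)) \<bullet> h\<bar>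
          \<le> (L * norm ((x - y) /\<^sub>R l - (x' - y) /\<^sub>R l)) * norm h"
        using Cauchy_Schwarz_ineq2 mult_right_mono[OF lip norm_ge_zero] by (rule order_trans)
      also have "(x - y) /\<^sub>R l - (x' - y) /\<^sub>R l = (x - x') /\<^sub>R l"
        by (simp add: algebra_simps)
      also have "norm ((x - x') /\<^sub>R l) = norm (x - x') / l"
        using l by (simp add: divide_inverse_commute)
      finally have le: "\<bar>(g ((x - y) /\<^sub>R l) - g ((x' - y) /\<^sub>R l)) \<bullet> h\<bar>
          \<le> L * (norm (x - x') / l) * norm h" .
      have "norm (q x h y - q x' h y) = \<bar>(g ((x - y) /\<^sub>R l) - g ((x' - y) /\<^sub>R l)) \<bullet> h\<bar> / l ^ 4"
        using l by (simp add: q_def inner_diff_left diff_divide_distrib[symmetric])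
      also have "\<dots> \<le> L * (norm (x - x') / l) * norm h / l ^ 4"
        using le l by (intro divide_right_mono) auto
      also have "\<dots> = L / l ^ 5 * norm (x - x') * norm h"
        using l by (simp add: divide_simps eval_nat_numeral)
      finally show ?thesis .
    qed
    note diff_bound = this
    have "D x h - D x' h = (LINT y|lebesgue. (q x h y - q x' h y) *\<^sub>R f y)"
      unfolding D_def scaleR_diff_left by (rule Bochner_Integration.integral_diff[symmetric]; rule q_int)
    also have "norm \<dots> \<le> 2 * (L / l ^ 5 * norm (x - x') * norm h) * I"
      by (rule pairing(2)[where x = x and x' = x', OF _ diff_bound]) (use \<open>0 \<le> L\<close> l q_zero in auto)
    finally show ?thesis by (simp add: mult_ac)
  qed
  have lin: "bounded_linear (D x)" for x
  proof (rule bounded_linear_intro[where K = "2 * (A / l ^ 4) * I"])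
    show "D x (h + h') = D x h + D x h'" for h h'
      unfolding D_def using Bochner_Integration.integral_add[OF q_int q_int, of x h x h']
      by (simp add: q_def inner_add_right add_divide_distrib scaleR_add_left)
    show "D x (c *\<^sub>R h) = c *\<^sub>R D x h" for c h
      unfolding D_def using integral_scaleR_right[of lebesgue c "\<lambda>y. q x h y *\<^sub>R f y"]
      by (simp add: q_def)
    show "norm (D x h) \<le> norm h * (2 * (A / l ^ 4) * I)" for h
      using D_bound[of x h] by (simp add: mult_ac)
  qed
  have remainder: "norm (mollify \<phi> l f (x + h) - mollify \<phi> l f x - D x h)
      \<le> 2 * (L / l ^ 5) * I * (norm h)\<^sup>2" for x h
  proof -
    let ?w = "\<lambda>y. p (x + h) y - p x y - q x h y"
    have w_bound: "norm (?w y) \<le> L / l ^ 5 * (norm h)\<^sup>2" for y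
    proof -
      define z where "z = (x - y) /\<^sub>R l"
      have z: "(x + h - y) /\<^sub>R l = z + h /\<^sub>R l"
        by (simp add: z_def algebra_simps)
      \<comment> \<open>In the rescaled variable the weight is the first-order Taylor remainder of
        \<open>\<phi>\<close> at \<open>z\<close> with increment \<open>h /\<^sub>R l\<close>,
        divided by \<open>l ^ 3\<close>. The squared increment supplies the other two powers of
        \<open>l\<close>.\<close>
      have "?w y = (\<phi> (z + h /\<^sub>R l) - \<phi> z - g z \<bullet> (h /\<^sub>R l)) / l ^ 3"
        using l unfolding p_def q_def z z_def[symmetric]
        by (simp add: divide_simps eval_nat_numeral algebra_simps)
      also have "norm \<dots> \<le> (L * (norm (h /\<^sub>R l))\<^sup>2) / l ^ 3"
        using l gradient_lipschitz_taylor[OF deriv lip \<open>0 \<le> L\<close>, of z "h /\<^sub>R l"]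
        by (simp add: divide_right_mono)
      also have "\<dots> = L / l ^ 5 * (norm h)\<^sup>2"
        using l by (simp add: power_mult_distrib divide_simps eval_nat_numeral)
      finally show ?thesis .
    qed
    have "mollify \<phi> l f (x + h) - mollify \<phi> l f x - D x h = (LINT y|lebesgue. ?w y *\<^sub>R f y)"
      unfolding U D_def scaleR_diff_left using p_int q_int
      by (simp add: Bochner_Integration.integral_diff Bochner_Integration.integrable_diff)
    also have "norm \<dots> \<le> 2 * (L / l ^ 5 * (norm h)\<^sup>2) * I"
    proof (rule pairing(2)[where x = x and x' = "x + h", OF _ w_bound])
      show "?w y = 0" if "l \<le> norm (x - y)" "l \<le> norm (x + h - y)" for y
        using that q_zero far by (simp add: p_def \<phi>_zero)
    qed (use \<open>0 \<le> L\<close> l in auto)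
    finally show ?thesis by (simp add: mult_ac)
  qed
  show ?thesis
  proof
    fix x
    have "(\<lambda>h. norm (mollify \<phi> l f (x + h) - mollify \<phi> l f x - D x h) / norm h) \<midarrow>0\<rightarrow> 0"
    proof (rule Lim_null_comparison)
      show "\<forall>\<^sub>F h in at 0. norm (norm (mollify \<phi> l f (x + h) - mollify \<phi> l f x - D x h) / norm h)
          \<le> 2 * (L / l ^ 5) * I * norm h"
        using remainder[of x] l
        by (auto simp: eventually_at_filter power2_eq_square pos_divide_le_eq mult.assoc)
      show "(\<lambda>h. 2 * (L / l ^ 5) * I * norm h) \<midarrow>0\<rightarrow> 0"
        using l by (auto intro!: tendsto_eq_intros)
    qed
    with lin show "(mollify \<phi> l f has_derivative D x) (at x)"
      by (simp add: has_derivative_at)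
  qed (fact D_bound D_lip)+
qed

section \<open>Strain and vorticity of a differentiable field\<close>

lemma jacobian_entry:
  fixes F :: "real^3 \<Rightarrow> real^3"
  assumes "(F has_derivative D) (at x)"
  shows "jacobian F (at x) $ i $ j = D (axis j 1) $ i"
  using frechet_derivative_at[OF assms] by (simp add: jacobian_def matrix_def)

text \<open>Each entry of the Jacobian is at most \<open>a\<close> and varies by at most
  \<open>b * norm (x - x')\<close>. A component of the curl is a difference of two entries, and the
  norm is at most the sum over three components; hence the factor 6.\<close>

lemma strain_curl_bounds:
  fixes F :: "real^3 \<Rightarrow> real^3"
  assumes D: "\<And>x. (F has_derivative D x) (at x)"
    and bound: "\<And>x h. norm (D x h) \<le> a * norm h"
    and lip: "\<And>x x' h. norm (D x h - D x' h) \<le> b * norm (x - x') * norm h"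
  shows "\<bar>strain F x $ i $ j\<bar> \<le> a"
    and "norm (curl F x) \<le> 6 * a"
    and "norm (curl F x - curl F x') \<le> 6 * b * norm (x - x')"
proof -
  have e: "\<bar>D x (axis j 1) $ i\<bar> \<le> a" for x i j
    using component_le_norm_cart[of "D x (axis j 1)" i] bound[of x "axis j 1"] by simp
  have d: "\<bar>D x (axis j 1) $ i - D x' (axis j 1) $ i\<bar> \<le> b * norm (x - x')" for x x' i j
    using component_le_norm_cart[of "D x (axis j 1) - D x' (axis j 1)" i] lip[of x "axis j 1" x'] by simp
  note J = jacobian_entry[OF D]
  show "\<bar>strain F x $ i $ j\<bar> \<le> a"
    using e[of x j i] e[of x i j] by (simp add: strain_def J transpose_def)
  have sum_le: "norm v \<le> 6 * c" if "\<And>i. \<bar>v $ i\<bar> \<le> 2 * c" for v :: "real^3" and c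
    using norm_le_l1_cart[of v] sum_bounded_above[of "UNIV :: 3 set" "\<lambda>i. \<bar>v $ i\<bar>" "2 * c"] that by simp
  have curl: "curl F x $ 1 = D x (axis 2 1) $ 3 - D x (axis 3 1) $ 2"
    "curl F x $ 2 = D x (axis 3 1) $ 1 - D x (axis 1 1) $ 3"
    "curl F x $ 3 = D x (axis 1 1) $ 2 - D x (axis 2 1) $ 1" for x
    by (simp_all add: curl_def J Let_def)
  have e2: "\<bar>D x (axis j 1) $ i - D x (axis i 1) $ j\<bar> \<le> 2 * a" for x i j
    using e[of x j i] e[of x i j] by linarith
  have "\<forall>i. \<bar>curl F x $ i\<bar> \<le> 2 * a"
    unfolding forall_3 curl by (intro conjI e2)
  then show "norm (curl F x) \<le> 6 * a"
    by (intro sum_le) simp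
  have d2: "\<bar>D x (axis j 1) $ i - D x (axis i 1) $ j - (D x' (axis j 1) $ i - D x' (axis i 1) $ j)\<bar>
      \<le> 2 * (b * norm (x - x'))" for i j
    using d[of x j i x'] d[of x i j x'] by linarith
  have "\<forall>i. \<bar>(curl F x - curl F x') $ i\<bar> \<le> 2 * (b * norm (x - x'))"
    unfolding forall_3 vector_minus_component curl by (intro conjI d2)
  then show "norm (curl F x - curl F x') \<le> 6 * b * norm (x - x')"
    using sum_le[of "curl F x - curl F x'" "b * norm (x - x')"] by simp
qed

lemma quadratic_form_bound:
  fixes S :: "real^3^3"
  assumes "\<And>i j. \<bar>S $ i $ j\<bar> \<le> c"
  shows "(S *v x) \<bullet> x \<le> 9 * c * (norm x)\<^sup>2"
proof -
  have "(S *v x) \<bullet> x = (\<Sum>i\<in>UNIV. \<Sum>j\<in>UNIV. S $ i $ j * (x $ j * x $ i))"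
    by (simp add: inner_vec_def matrix_vector_mult_def sum_distrib_right mult.assoc)
  also have "\<dots> \<le> (\<Sum>i\<in>(UNIV :: 3 set). \<Sum>j\<in>(UNIV :: 3 set). c * (norm x)\<^sup>2)"
  proof (intro sum_mono)
    fix i j
    have "\<bar>x $ j * x $ i\<bar> \<le> norm x * norm x"
      unfolding abs_mult by (intro mult_mono component_le_norm_cart) auto
    then have "\<bar>S $ i $ j * (x $ j * x $ i)\<bar> \<le> c * (norm x)\<^sup>2"
      using assms[of i j] unfolding abs_mult[of "S $ i $ j"] power2_eq_square by (intro mult_mono) auto
    then show "S $ i $ j * (x $ j * x $ i) \<le> c * (norm x)\<^sup>2"
      by linarith
  qed
  finally show ?thesis by simp
qed

section \<open>The far-field stretching term\<close>

text \<open>\<open>M_E\<close> is an essential supremum over time, whereas the stretching is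
  integrated over space-time. The exceptional times are enclosed in a Borel null set
  \<open>N\<close>, and \<open>UNIV \<times> N\<close> is null for the product measure.\<close>

lemma AE_M_E_bound:
  assumes J: "is_interval J" and fin: "M_E J u < \<infinity>"
  shows "AE (x, t) in (lebesgue :: ((real^3) \<times> real) measure). t \<in> J \<longrightarrow> L2sq (u t) \<le> ennreal (enn2real (M_E J u))"
proof -
  have "J \<in> sets lebesgue"
    using real_interval_borel_measurable[OF J] by simp
  then have "AE t in lebesgue. t \<in> J \<longrightarrow> L2sq (u t) \<le> M_E J u"
    using esssup_AE[of "\<lambda>t. L2sq (u t)" "lebesgue_on J"] by (simp add: M_E_def AE_restrict_space_iff)
  then have "AE t in lborel. t \<in> J \<longrightarrow> L2sq (u t) \<le> M_E J u"
    by (simp add: AE_completion_iff)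
  then obtain N where N: "{t. \<not> (t \<in> J \<longrightarrow> L2sq (u t) \<le> M_E J u)} \<subseteq> N" "N \<in> null_sets lborel"
    by (auto elim!: AE_E simp: null_sets_def)
  have "(UNIV :: (real^3) set) \<times> N \<in> null_sets (lborel \<Otimes>\<^sub>M lborel)"
    using N(2) by (intro lborel.times_in_null_sets2) auto
  then have "(UNIV :: (real^3) set) \<times> N \<in> null_sets lebesgue"
    by (simp add: lborel_prod null_sets_completionI)
  then show ?thesis
    by (rule AE_I') (use N(1) fin in auto)
qed

text \<open>\<open>a\<close> bounds the derivative of \<open>U\<close> and \<open>b\<close> is a
  Lipschitz constant for it. The full strain contributes \<open>a\<close>, the near strain the term
  with \<open>b * d\<close>, and the vorticity is at most \<open>6 * a\<close>; the leading 9 counts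
  the matrix entries.\<close>

lemma stretching_far_bound:
  fixes f :: "real^3 \<Rightarrow> real^3"
  assumes deriv: "\<And>z. (\<phi> has_derivative (\<lambda>h. g z \<bullet> h)) (at z)"
    and A: "\<And>z. norm (g z) \<le> A" "0 \<le> A"
    and lip: "\<And>z z'. norm (g z - g z') \<le> L * norm (z - z')" "0 \<le> L"
    and zero: "\<And>z. 1 \<le> norm z \<Longrightarrow> \<phi> z = 0" "\<And>z. 1 \<le> norm z \<Longrightarrow> g z = 0"
    and \<theta>: "splitting_profile \<theta>"
    and f: "f \<in> borel_measurable lebesgue"
    and M: "L2sq f \<le> ennreal M" "0 \<le> M" and l: "0 < l" and d: "0 < d"
  defines "U \<equiv> mollify \<phi> l f"
    and "I \<equiv> sqrt (unit_ball_vol 3 * l ^ 3 * M)"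
  defines "a \<equiv> 2 * (A / l ^ 4) * I" and "b \<equiv> 2 * (L / l ^ 5) * I"
  shows "(strain_far \<theta> d U x *v curl U x) \<bullet> curl U x
    \<le> 9 * (a + 36 * unit_ball_vol 3 * b * d) * (6 * a)\<^sup>2"
proof -
  obtain D where D: "\<And>x. (U has_derivative D x) (at x)"
    "\<And>x h. norm (D x h) \<le> a * norm h"
    "\<And>x x' h. norm (D x h - D x' h) \<le> b * norm (x - x') * norm h"
    unfolding U_def a_def b_def I_def
    using mollify_derivative[OF deriv A lip zero f M l] by metis
  note S = strain_curl_bounds[OF D]
  have ab: "0 \<le> a" "0 \<le> b"
    using A lip M l by (auto simp: a_def b_def I_def)
  have \<theta>': "continuous_on UNIV \<theta>" "\<bar>\<theta> z\<bar> \<le> 1" "1 \<le> norm z \<Longrightarrow> \<theta> z = 0" "norm z = norm z' \<Longrightarrow> \<theta> z = \<theta> z'" for z z'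
  proof -
    have "smooth \<theta>" and supp: "supp \<theta> \<subseteq> ball 0 1"
      using \<theta> unfolding splitting_profile_def test_fun_def by blast+
    then have "Ck 0 \<theta>" unfolding smooth_def by blast
    then show "continuous_on UNIV \<theta>" by simp
    show "\<theta> z = 0" if "1 \<le> norm z"
      using that supp by (intro eq_0_outside_supp) auto
    have "0 \<le> \<theta> z \<and> \<theta> z \<le> 1"
      using \<theta> unfolding splitting_profile_def by blast
    then show "\<bar>\<theta> z\<bar> \<le> 1" by simp
    show "\<theta> z = \<theta> z'" if "norm z = norm z'"
      using \<theta> that unfolding splitting_profile_def by blast
  qed
  have "norm (strain_near \<theta> d (curl U) x) \<le> 3 / (8 * pi) * (16 * (6 * b) * unit_ball_vol 3 * d)"
    unfolding strain_near_def strain_kernel_def[symmetric] norm_scaleR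
    using ab by (intro mult_mono pv_strain_kernel[OF \<theta>' S(3) _ d]) auto
  \<comment> \<open>Here 36 is \<open>3 / 8 * 16 * 6\<close>, the 6 stemming from the Lipschitz
    constant \<open>6 * b\<close> of the curl. The factor \<open>1 / pi\<close> is then
    dropped.\<close>
  also have "\<dots> = (36 * unit_ball_vol 3 * b * d) / pi"
    by simp
  also have "\<dots> \<le> (36 * unit_ball_vol 3 * b * d) / 1"
    using ab d pi_gt3 by (intro divide_left_mono) auto
  finally have near: "norm (strain_near \<theta> d (curl U) x) \<le> 36 * unit_ball_vol 3 * b * d"
    by simp
  have "\<bar>strain_far \<theta> d U x $ i $ j\<bar> \<le> a + 36 * unit_ball_vol 3 * b * d" for i j
  proof -
    have "\<bar>strain_near \<theta> d (curl U) x $ i $ j\<bar> \<le> 36 * unit_ball_vol 3 * b * d"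
      using near component_le_norm_cart[of "strain_near \<theta> d (curl U) x $ i" j]
        Finite_Cartesian_Product.norm_nth_le[of "strain_near \<theta> d (curl U) x" i] by linarith
    then show ?thesis
      using S(1)[of x i j] by (simp add: strain_far_def)
  qed
  then have "(strain_far \<theta> d U x *v curl U x) \<bullet> curl U x
      \<le> 9 * (a + 36 * unit_ball_vol 3 * b * d) * (norm (curl U x))\<^sup>2"
    by (rule quadratic_form_bound)
  also have "\<dots> \<le> 9 * (a + 36 * unit_ball_vol 3 * b * d) * (6 * a)\<^sup>2"
    using S(2)[of x] ab d by (intro mult_left_mono power_mono) auto
  finally show ?thesis .
qed

lemma leray_hopfD:
  assumes "leray_hopf J u"
  shows "is_interval J" and "M_E J u < \<infinity>" and "t \<in> J \<Longrightarrow> in_L2 (u t)"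
proof -
  note u = assms[unfolded leray_hopf_def]
  show "is_interval J" using u by (elim conjE)
  show "M_E J u < \<infinity>" using u by (elim conjE)
  have "\<forall>t\<in>J. in_L2 (u t) \<and> weakly_div_free (u t)" using u by (elim conjE)
  then show "t \<in> J \<Longrightarrow> in_L2 (u t)" by blast
qed

section \<open>Powers of the dyadic radius and integration over the cylinder\<close>

lemma rad_pos: "0 < rad k"
  by (simp add: rad_def)

lemma rad_powr: "rad k = 2 powr (- real k)"
  by (simp add: rad_def powr_minus powr_realpow divide_inverse)

lemma emeasure_Q: "emeasure lebesgue (Q x0 t0 k) = ennreal (unit_ball_vol 3 * rad k ^ 5)"
proof -
  have "emeasure lebesgue (Q x0 t0 k) = emeasure (lborel \<Otimes>\<^sub>M lborel) (ball x0 (rad k) \<times> {t0 - (rad k)\<^sup>2<..<t0})"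
    by (simp add: Q_def lborel_prod borel_open open_Times)
  also have "\<dots> = emeasure lborel (ball x0 (rad k)) * emeasure lborel {t0 - (rad k)\<^sup>2<..<t0}"
    by (intro lborel.emeasure_pair_measure_Times) auto
  also have "\<dots> = ennreal (unit_ball_vol 3 * rad k ^ 3) * ennreal ((rad k)\<^sup>2)"
    using rad_pos[of k] by (simp add: emeasure_ball3)
  also have "\<dots> = ennreal (unit_ball_vol 3 * rad k ^ 5)"
    using rad_pos[of k] by (simp add: ennreal_mult[symmetric] eval_nat_numeral mult_ac)
  finally show ?thesis .
qed

text \<open>Count of exponents: the square root scales like \<open>r powr (3/2)\<close>, so
  \<open>a\<close> scales like \<open>r powr (-5/2)\<close>. The extra inverse power of
  \<open>r\<close> in \<open>b\<close> is compensated by the splitting distance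
  \<open>\<rho> * r\<close>.\<close>

lemma V_far_scaling:
  fixes A L \<rho> \<sigma> M :: real
  assumes "0 < \<rho>" "0 < \<sigma>" "0 \<le> M"
  defines "v \<equiv> unit_ball_vol 3"
  defines "\<alpha> \<equiv> 2 * A / \<sigma> ^ 4 * sqrt (v * \<sigma> ^ 3)" and "\<beta> \<equiv> 2 * L / \<sigma> ^ 5 * sqrt (v * \<sigma> ^ 3) * \<rho>"
  assumes a: "a = 2 * (A / (\<sigma> * rad k) ^ 4) * sqrt (v * (\<sigma> * rad k) ^ 3 * M)"
    and b: "b = 2 * (L / (\<sigma> * rad k) ^ 5) * sqrt (v * (\<sigma> * rad k) ^ 3 * M)"
  shows "rad k * (9 * (a + 36 * v * b * (\<rho> * rad k)) * (6 * a)\<^sup>2 * (v * rad k ^ 5))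
    = 324 * v * (\<alpha> + 36 * v * \<beta>) * \<alpha>\<^sup>2 * M powr (3/2) * 2 powr (3 * real k / 2)"
proof -
  define r where "r = rad k"
  define s where "s = sqrt r * sqrt M"
  have r: "0 < r" by (simp add: r_def rad_pos)
  have sq: "sqrt (v * (\<sigma> * r) ^ 3 * M) = sqrt (v * \<sigma> ^ 3) * (r * s)"
    using r \<open>0 < \<sigma>\<close> by (simp add: s_def power_mult_distrib real_sqrt_mult power3_eq_cube)
  \<comment> \<open>This is \<open>r powr (-5/2) * sqrt M\<close>, the common scale of
    \<open>a\<close> and \<open>b * (\<rho> * r)\<close>.\<close>
  define X where "X = s / r ^ 3"
  have a': "a = \<alpha> * X"
    using r \<open>0 < \<sigma>\<close> unfolding a r_def[symmetric] sq
    by (simp add: \<alpha>_def X_def power_mult_distrib divide_simps eval_nat_numeral)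
  have b': "b * (\<rho> * r) = \<beta> * X"
    using r \<open>0 < \<sigma>\<close> unfolding b r_def[symmetric] sq
    by (simp add: \<beta>_def X_def power_mult_distrib divide_simps eval_nat_numeral)
  have "r * (9 * (a + 36 * v * b * (\<rho> * r)) * (6 * a)\<^sup>2 * (v * r ^ 5))
      = r * (9 * (a + 36 * v * (b * (\<rho> * r))) * (6 * a)\<^sup>2 * (v * r ^ 5))"
    by (simp add: mult.assoc)
  \<comment> \<open>324 is \<open>9 * 6\<^sup>2\<close>, and \<open>r ^ 6\<close> joins the
    prefactor \<open>r\<close> with the volume factor \<open>r ^ 5\<close>.\<close>
  also have "\<dots> = 324 * v * (\<alpha> + 36 * v * \<beta>) * \<alpha>\<^sup>2 * (X ^ 3 * r ^ 6)"
    unfolding a' b' by algebra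
  also have "X ^ 3 * r ^ 6 = s ^ 3 / r ^ 3"
    using r by (simp add: X_def power_divide divide_simps power_mult[symmetric] power_add[symmetric])
  also have "s ^ 3 / r ^ 3 = M powr (3/2) * 2 powr (3 * real k / 2)"
  proof -
    \<comment> \<open>The value 0 is treated separately because \<open>M\<close> may vanish.\<close>
    have cube: "sqrt y ^ 3 = y powr (3/2)" if "0 \<le> y" for y
      using that by (cases "y = 0") (simp_all add: powr_half_sqrt[symmetric] powr_power)
    have "s ^ 3 / r ^ 3 = M powr (3/2) * (r powr (3/2) / r powr 3)"
      using r \<open>0 \<le> M\<close> by (simp add: s_def power_mult_distrib cube powr_numeral)
    also have "r powr (3/2) / r powr 3 = r powr (-3/2)"
      by (simp only: powr_diff[symmetric]) simp
    also have "r powr (-3/2) = 2 powr (3 * real k / 2)"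
      by (simp add: r_def rad_powr powr_powr mult.commute)
    finally show ?thesis .
  qed
  finally show ?thesis by (simp add: r_def mult.assoc)
qed

text \<open>The cutoff is at most 1, so a pointwise bound \<open>B\<close> integrates to
  \<open>B\<close> times the volume of the cylinder. As \<open>rad k\<close> is at most 1, all times
  of the cylinder lie in \<open>J\<close>. The bound is asked only at times with controlled energy,
  which are almost all of them.\<close>

lemma V_far_le:
  assumes \<eta>: "\<And>p. 0 \<le> \<eta> p \<and> \<eta> p \<le> 1"
    and J: "{t0 - 1<..<t0} \<subseteq> J" "is_interval J" "M_E J u < \<infinity>"
    and B: "0 \<le> B" "\<And>t x. t \<in> J \<Longrightarrow> L2sq (u t) \<le> ennreal (enn2real (M_E J u)) \<Longrightarrow>
      (strain_far \<theta> (\<rho> * rad k) (mollify \<phi> (\<sigma> * rad k) (u t)) x *v curl (mollify \<phi> (\<sigma> * rad k) (u t)) x)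
        \<bullet> curl (mollify \<phi> (\<sigma> * rad k) (u t)) x \<le> B"
  shows "V_far \<phi> \<eta> \<theta> \<rho> \<sigma> x0 t0 u k \<le> ennreal (rad k * (B * (unit_ball_vol 3 * rad k ^ 5)))"
proof -
  let ?S = "\<lambda>x t. (strain_far \<theta> (\<rho> * rad k) (mollify \<phi> (\<sigma> * rad k) (u t)) x *v curl (mollify \<phi> (\<sigma> * rad k) (u t)) x)
        \<bullet> curl (mollify \<phi> (\<sigma> * rad k) (u t)) x"
  let ?F = "\<lambda>(x, t). ennreal (\<eta> ((x - x0) /\<^sub>R rad k, (t - t0) / (rad k)\<^sup>2) * max 0 (?S x t))"
  have "(rad k)\<^sup>2 \<le> 1"
    by (simp add: rad_def power_divide)
  then have QJ: "t \<in> J" if "(x, t) \<in> Q x0 t0 k" for x t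
    using that J(1) by (auto simp: Q_def)
  have "AE p in lebesgue. ?F p * indicator (Q x0 t0 k) p \<le> ennreal B * indicator (Q x0 t0 k) p"
    using AE_M_E_bound[OF J(2,3)]
  proof eventually_elim
    case (elim p)
    obtain x t where p: "p = (x, t)" by (cases p)
    show ?case
    proof (cases "p \<in> Q x0 t0 k")
      case True
      then have "t \<in> J" unfolding p by (rule QJ)
      moreover from this have "L2sq (u t) \<le> ennreal (enn2real (M_E J u))"
        using elim unfolding p by simp
      ultimately have "?S x t \<le> B" by (rule B(2))
      then have "max 0 (?S x t) \<le> B" using B(1) by (rule max.boundedI[rotated])
      then have "\<eta> ((x - x0) /\<^sub>R rad k, (t - t0) / (rad k)\<^sup>2) * max 0 (?S x t) \<le> 1 * B"
        using \<eta> B(1) by (intro mult_mono) auto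
      then show ?thesis
        using True by (simp add: p ennreal_leI)
    qed simp
  qed
  \<comment> \<open>Almost-everywhere monotonicity of \<open>nn_integral\<close> holds for arbitrary
    integrands.\<close>
  then have "(\<integral>\<^sup>+ p. ?F p * indicator (Q x0 t0 k) p \<partial>lebesgue) \<le> (\<integral>\<^sup>+ p. ennreal B * indicator (Q x0 t0 k) p \<partial>lebesgue)"
    by (rule nn_integral_mono_AE)
  also have "\<dots> = ennreal B * emeasure lebesgue (Q x0 t0 k)"
    unfolding Q_def by (rule nn_integral_cmult_indicator) (simp add: open_Times borel_open)
  also have "\<dots> = ennreal B * ennreal (unit_ball_vol 3 * rad k ^ 5)"
    by (simp only: emeasure_Q)
  finally have "V_far \<phi> \<eta> \<theta> \<rho> \<sigma> x0 t0 u k \<le> ennreal (rad k) * (ennreal B * ennreal (unit_ball_vol 3 * rad k ^ 5))"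
    unfolding V_far_def Let_def by (intro mult_left_mono) (simp_all add: case_prod_beta)
  also have "\<dots> = ennreal (rad k * (B * (unit_ball_vol 3 * rad k ^ 5)))"
    using B(1) rad_pos[of k] by (simp add: ennreal_mult)
  finally show ?thesis .
qed

theorem theorem8p2:
  fixes \<phi> :: "real^3 \<Rightarrow> real" and \<eta> :: "(real^3) \<times> real \<Rightarrow> real" and \<rho> \<sigma> :: real
  assumes "filter_profile \<phi>" and "cutoff_profile \<eta>"
    and "0 < \<rho>" "\<rho> \<le> 1/4" and "0 < \<sigma>" "\<sigma> < 1"
  shows "\<exists>C\<ge>0. \<forall>\<theta> J u x0 t0.
    splitting_profile \<theta> \<and> leray_hopf J u \<and> {t0 - 1<..<t0} \<subseteq> J \<longrightarrow>
      (\<forall>k. V_far \<phi> \<eta> \<theta> \<rho> \<sigma> x0 t0 u k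
             \<le> ennreal (C * enn2real (M_E J u) powr (3/2) * 2 powr (3 * real k / 2))) \<and>
      (\<forall>w::nat \<Rightarrow> real. (\<forall>k. 0 \<le> w k) \<and> summable (\<lambda>k. 2 powr (3 * real k / 2) * w k) \<longrightarrow>
         (\<forall>N. (\<Sum>k=0..N. ennreal (w k) * V_far \<phi> \<eta> \<theta> \<rho> \<sigma> x0 t0 u k)
             \<le> ennreal (C * enn2real (M_E J u) powr (3/2)
                        * (\<Sum>k. 2 powr (3 * real k / 2) * w k))))"
proof -
  have "test_fun (ball 0 1) \<phi>"
    using assms(1) by (simp add: filter_profile_def)
  then obtain g A L where A: "0 \<le> A" and L: "0 \<le> L"
    and deriv: "\<And>z. (\<phi> has_derivative (\<lambda>h. g z \<bullet> h)) (at z)"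
    and gA: "\<And>z. norm (g z) \<le> A" and gL: "\<And>z z'. norm (g z - g z') \<le> L * norm (z - z')"
    and zero: "\<And>z. 1 \<le> norm z \<Longrightarrow> \<phi> z = 0" "\<And>z. 1 \<le> norm z \<Longrightarrow> g z = 0"
    by (rule test_fun_gradient) (assumption | rule that)+
  define v where "v = unit_ball_vol 3"
  define \<alpha> where "\<alpha> = 2 * A / \<sigma> ^ 4 * sqrt (v * \<sigma> ^ 3)"
  define \<beta> where "\<beta> = 2 * L / \<sigma> ^ 5 * sqrt (v * \<sigma> ^ 3) * \<rho>"
  \<comment> \<open>\<open>C\<close> is fixed before \<open>\<theta>\<close>, \<open>J\<close>,
    \<open>u\<close> and the base point. It depends on the filter through \<open>A\<close> and
    \<open>L\<close>, on \<open>\<sigma>\<close>, and through \<open>\<beta>\<close> on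
    \<open>\<rho>\<close>.\<close>
  define C where "C = 324 * v * (\<alpha> + 36 * v * \<beta>) * \<alpha>\<^sup>2"
  have v: "0 \<le> v" by (simp add: v_def)
  then have C: "0 \<le> C"
    using A L assms(3,5) by (simp add: C_def \<alpha>_def \<beta>_def)
  have bound: "V_far \<phi> \<eta> \<theta> \<rho> \<sigma> x0 t0 u k
      \<le> ennreal (C * enn2real (M_E J u) powr (3/2) * 2 powr (3 * real k / 2))"
    if \<theta>: "splitting_profile \<theta>" and u: "leray_hopf J u" and J: "{t0 - 1<..<t0} \<subseteq> J" for \<theta> J u x0 t0 k
  proof -
    define M where "M = enn2real (M_E J u)"
    have M: "0 \<le> M" by (simp add: M_def)
    define a where "a = 2 * (A / (\<sigma> * rad k) ^ 4) * sqrt (v * (\<sigma> * rad k) ^ 3 * M)"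
    define b where "b = 2 * (L / (\<sigma> * rad k) ^ 5) * sqrt (v * (\<sigma> * rad k) ^ 3 * M)"
    define B where "B = 9 * (a + 36 * v * b * (\<rho> * rad k)) * (6 * a)\<^sup>2"
    have pos: "0 < \<sigma> * rad k" "0 < \<rho> * rad k"
      using assms(3,5) rad_pos by simp_all
    have "V_far \<phi> \<eta> \<theta> \<rho> \<sigma> x0 t0 u k \<le> ennreal (rad k * (B * (unit_ball_vol 3 * rad k ^ 5)))"
    proof (rule V_far_le[OF _ J])
      show "0 \<le> \<eta> p \<and> \<eta> p \<le> 1" for p
        using assms(2) unfolding cutoff_profile_def by blast
      show "is_interval J" "M_E J u < \<infinity>"
        by (rule leray_hopfD[OF u])+
      show "0 \<le> B"
        using A L M v pos by (simp add: B_def a_def b_def)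
      fix t x assume t: "t \<in> J" "L2sq (u t) \<le> ennreal (enn2real (M_E J u))"
      have "u t \<in> borel_measurable lebesgue"
        using leray_hopfD(3)[OF u t(1)] by (simp add: in_L2_def)
      from stretching_far_bound[OF deriv gA A gL L zero \<theta> this t(2)[folded M_def] M pos, of x]
      show "(strain_far \<theta> (\<rho> * rad k) (mollify \<phi> (\<sigma> * rad k) (u t)) x *v curl (mollify \<phi> (\<sigma> * rad k) (u t)) x)
        \<bullet> curl (mollify \<phi> (\<sigma> * rad k) (u t)) x \<le> B"
        by (simp add: B_def a_def b_def v_def)
    qed
    also have "rad k * (B * (unit_ball_vol 3 * rad k ^ 5)) = C * M powr (3/2) * 2 powr (3 * real k / 2)"
      using V_far_scaling[OF assms(3,5) M a_def[unfolded v_def] b_def[unfolded v_def]]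
      by (simp add: B_def C_def \<alpha>_def \<beta>_def v_def)
    finally show ?thesis
      by (simp add: M_def)
  qed
  show ?thesis
  proof (intro exI[of _ C] conjI C allI impI; (elim conjE)?)
    fix \<theta> J u x0 t0 k
    assume "splitting_profile \<theta>" "leray_hopf J u" "{t0 - 1<..<t0} \<subseteq> J"
    then show "V_far \<phi> \<eta> \<theta> \<rho> \<sigma> x0 t0 u k
        \<le> ennreal (C * enn2real (M_E J u) powr (3/2) * 2 powr (3 * real k / 2))"
      by (rule bound)
  next
    fix \<theta> J u x0 t0 and w :: "nat \<Rightarrow> real" and N
    assume h: "splitting_profile \<theta>" "leray_hopf J u" "{t0 - 1<..<t0} \<subseteq> J"
      and w: "\<forall>k. 0 \<le> w k" and sum: "summable (\<lambda>k. 2 powr (3 * real k / 2) * w k)"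
    let ?c = "C * enn2real (M_E J u) powr (3/2)"
    \<comment> \<open>The bound at each scale is inserted termwise; the partial sum is then at most
      the full series, whose terms are nonnegative.\<close>
    have "(\<Sum>k=0..N. ennreal (w k) * V_far \<phi> \<eta> \<theta> \<rho> \<sigma> x0 t0 u k)
        \<le> (\<Sum>k=0..N. ennreal (w k) * ennreal (?c * 2 powr (3 * real k / 2)))"
      by (intro sum_mono mult_left_mono bound h) simp
    also have "\<dots> = (\<Sum>k=0..N. ennreal (?c * (2 powr (3 * real k / 2) * w k)))"
      using w C by (intro sum.cong refl) (simp add: ennreal_mult[symmetric] mult_ac)
    also have "\<dots> = ennreal (?c * (\<Sum>k=0..N. 2 powr (3 * real k / 2) * w k))"
      using w C by (simp add: sum_ennreal sum_distrib_left)
    also have "\<dots> \<le> ennreal (?c * (\<Sum>k. 2 powr (3 * real k / 2) * w k))"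
      using w C by (intro ennreal_leI mult_left_mono sum_le_suminf sum) auto
    finally show "(\<Sum>k=0..N. ennreal (w k) * V_far \<phi> \<eta> \<theta> \<rho> \<sigma> x0 t0 u k)
        \<le> ennreal (?c * (\<Sum>k. 2 powr (3 * real k / 2) * w k))" .
  qed
qed

end
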